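(* Let $\mathscr{A}$ be a $C^*$-algebra and $\mathscr{E}$ be a full Hilbert $\mathscr{A}$-module. Let $T: \mathscr{E} \to \mathscr{E}$ be a linear operator and let $S: \mathscr{E} \to \mathscr{E}$ be an invertible linear operator with bounded inverse operator. Suppose that, for some invertible element $\gamma \in Z(M(\mathscr{A}))$, $\langle T(x), S(y) \rangle = \gamma \langle x,y \rangle$ for all $x,y\in\mathscr{E}$. Then $T$ and $S$ are bounded, $\mathscr{A}$-linear, adjointable, invertible, and $ST^*(x)= \gamma x$ and $S^*T(x) = \gamma^* x$ for all $x \in \mathscr{E}$, i.e. the pairs of operators $\{S, T^* \}$ and $\{S^*, T \}$ commute, and also $S=\gamma^{-1} (T^* )^{-1}$ and $T = \gamma^* (S^* )^{-1}$. In the special situation of $T=S$ the element $\gamma$ is positive and $T=\sqrt{\gamma}\,U$ for some unitary $\mathscr{A}$-linear operator $U$ on $\mathscr{E}$.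
   Context: A Hilbert $\mathscr{A}$-module is a (complex vector space and) left $\mathscr{A}$-module $\mathscr{E}$ with an $\mathscr{A}$-valued inner product $\langle\cdot,\cdot\rangle$ which is linear and $\mathscr{A}$-linear in the first variable, satisfies $\langle x,y\rangle^*=\langle y,x\rangle$, $\langle x,x\rangle\ge 0$ with equality if and only if $x=0$, and which is complete in the norm $\|x\|=\|\langle x,x\rangle\|^{1/2}$. It is full if the closed linear span of $\{\langle x,y\rangle : x,y\in\mathscr{E}\}$ equals $\mathscr{A}$. $Z(M(\mathscr{A}))$ is the center of the multiplier algebra $M(\mathscr{A})$ of $\mathscr{A}$; $M(\mathscr{A})$ acts on $\mathscr{E}$ by the unique extension of the $\mathscr{A}$-action, with $m(ax)=(ma)x$ for $m\in M(\mathscr{A})$, $a\in\mathscr{A}$, $x\in\mathscr{E}$. An operator $T$ is $\mathscr{A}$-linear if it is linear and $T(ax)=aT(x)$ for all $a\in\mathscr{A}$, $x\in\mathscr{E}$. An operator $T:\mathscr{E}\to\mathscr{E}$ is adjointable if there is an operator $T^*:\mathscr{E}\to\mathscr{E}$ with $\langle Tx,y\rangle=\langle x,T^*y\rangle$ for all $x,y\in\mathscr{E}$. A unitary operator $U$ is an adjointable operator with $U^*U=UU^*=I$, where $I$ is the identity operator.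
   Formalization: With the inner product linear in the first variable, the printed formulas fail (A=E=C, S=I, T=iI, γ=i; for S=γ^{-1}(T* )^{-1} also S=I, T=2I, γ=2); they are corrected to ST*=γ*, S*T=γ, S=γ*(T* )^{-1}, T=γ(S* )^{-1}. *)

theory Defs
  imports "HOL-Analysis.Analysis"
begin

section \<open>Complex vector spaces and $C^*$-algebras\<close>

class complex_vector = real_vector +
  fixes scaleC :: "complex \<Rightarrow> 'a \<Rightarrow> 'a" (infixr "*\<^sub>C" 75)
  assumes scaleC_add_right: "c *\<^sub>C (x + y) = c *\<^sub>C x + c *\<^sub>C y"
    and scaleC_add_left: "(c + d) *\<^sub>C x = c *\<^sub>C x + d *\<^sub>C x"
    and scaleC_scaleC: "c *\<^sub>C (d *\<^sub>C x) = (c * d) *\<^sub>C x"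
    and scaleC_one: "1 *\<^sub>C x = x"
    and scaleR_scaleC: "r *\<^sub>R x = complex_of_real r *\<^sub>C x"

interpretation complex_vector: vector_space "scaleC :: complex \<Rightarrow> 'a \<Rightarrow> 'a::complex_vector"
  by unfold_locales
    (simp_all add: scaleC_add_right scaleC_add_left scaleC_scaleC scaleC_one)

abbreviation clinear :: "('a::complex_vector \<Rightarrow> 'b::complex_vector) \<Rightarrow> bool"
  where "clinear \<equiv> Vector_Spaces.linear scaleC scaleC"

class complex_normed_vector = complex_vector + real_normed_vector +
  assumes norm_scaleC: "norm (c *\<^sub>C x) = cmod c * norm x"

class star =
  fixes star :: "'a \<Rightarrow> 'a"

text \<open>Not necessarily unital; the zero algebra is allowed.\<close>

class cstar_algebra = complex_normed_vector + real_normed_algebra + banach + star +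
  assumes mult_scaleC_left: "(c *\<^sub>C a) * b = c *\<^sub>C (a * b)"
    and mult_scaleC_right: "a * (c *\<^sub>C b) = c *\<^sub>C (a * b)"
    and star_add: "star (a + b) = star a + star b"
    and star_scaleC: "star (c *\<^sub>C a) = cnj c *\<^sub>C star a"
    and star_mult: "star (a * b) = star b * star a"
    and star_star: "star (star a) = a"
    and cstar_identity: "norm (star a * a) = (norm a)\<^sup>2"

text \<open>In a $C^*$-algebra the elements of this form are exactly the self-adjoint elements
  with spectrum in $[0,\infty)$.\<close>

definition cpositive :: "'a::{times,star} \<Rightarrow> bool"
  where "cpositive a \<longleftrightarrow> (\<exists>b. a = star b * b)"

definition pos_sqrt :: "'a::{times,star} \<Rightarrow> 'a"
  where "pos_sqrt a = (THE s. cpositive s \<and> s * s = a)"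


section \<open>The multiplier algebra\<close>

text \<open>The multiplier algebra is the algebra of double centralizers: pairs of maps $(L,R)$,
  to be read as left and right multiplication by a multiplier.\<close>

definition double_centralizer :: "('a::cstar_algebra \<Rightarrow> 'a) \<Rightarrow> ('a \<Rightarrow> 'a) \<Rightarrow> bool"
  where "double_centralizer L R \<longleftrightarrow>
    clinear L \<and> bounded_linear L \<and> clinear R \<and> bounded_linear R \<and>
    (\<forall>a b. L (a * b) = L a * b) \<and> (\<forall>a b. R (a * b) = a * R b) \<and>
    (\<forall>a b. R a * b = a * L b)"

lemma clinear_iff:
  "clinear f \<longleftrightarrow> (\<forall>x y. f (x + y) = f x + f y) \<and> (\<forall>c x. f (c *\<^sub>C x) = c *\<^sub>C f x)"
  by (simp add: Vector_Spaces.linear_iff complex_vector.vector_space_axioms)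

lemma double_centralizer_id: "double_centralizer (\<lambda>a. a) (\<lambda>a. a)"
  by (simp add: double_centralizer_def clinear_iff)

lemma double_centralizer_comp:
  assumes "double_centralizer L R" "double_centralizer L' R'"
  shows "double_centralizer (\<lambda>a. L (L' a)) (\<lambda>a. R' (R a))"
  using assms by (simp add: double_centralizer_def clinear_iff bounded_linear_compose)

lemma star_bounded_linear: "bounded_linear (star :: 'a::cstar_algebra \<Rightarrow> 'a)"
proof -
  have le: "norm a \<le> norm (star a)" for a :: 'a
  proof (cases "a = 0")
    case False
    have "norm a * norm a \<le> norm (star a) * norm a"
      using norm_mult_ineq[of "star a" a] by (simp add: cstar_identity power2_eq_square)
    with False show ?thesis by simp
  qed simp
  have "norm (star a) \<le> norm a * 1" for a :: 'a
    using le[of "star a"] by (simp add: star_star)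
  then show ?thesis
    by (intro bounded_linear_intro[where K = 1]) (auto simp: star_add scaleR_scaleC star_scaleC)
qed

lemma double_centralizer_star:
  assumes "double_centralizer L R"
  shows "double_centralizer (\<lambda>a. star (R (star a))) (\<lambda>a. star (L (star a)))"
proof -
  have "star (L (star a)) * b = a * star (R (star b))" for a b
  proof -
    have "star (star (L (star a)) * b) = star (a * star (R (star b)))"
      using assms by (simp add: double_centralizer_def star_mult star_star)
    then show ?thesis by (metis star_star)
  qed
  then show ?thesis
    using assms
    by (simp add: double_centralizer_def clinear_iff star_add star_scaleC star_mult star_star
        bounded_linear_compose[OF star_bounded_linear]
        bounded_linear_compose[OF bounded_linear_compose[OF star_bounded_linear]]
        bounded_linear_compose star_bounded_linear)
qed

typedef (overloaded) 'a multiplier =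
  "{(L :: 'a::cstar_algebra \<Rightarrow> 'a, R). double_centralizer L R}"
  using double_centralizer_id by auto

setup_lifting type_definition_multiplier

lift_definition lmul :: "'a::cstar_algebra multiplier \<Rightarrow> 'a \<Rightarrow> 'a" is fst .

lift_definition rmul :: "'a::cstar_algebra multiplier \<Rightarrow> 'a \<Rightarrow> 'a" is snd .

instantiation multiplier :: (cstar_algebra) "{monoid_mult, star}"
begin

lift_definition one_multiplier :: "'a multiplier" is "(\<lambda>a. a, \<lambda>a. a)"
  by (simp add: double_centralizer_id)

lift_definition times_multiplier :: "'a multiplier \<Rightarrow> 'a multiplier \<Rightarrow> 'a multiplier"
  is "\<lambda>(L, R) (L', R'). (\<lambda>a. L (L' a), \<lambda>a. R' (R a))"
  by (auto simp: double_centralizer_comp)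

lift_definition star_multiplier :: "'a multiplier \<Rightarrow> 'a multiplier"
  is "\<lambda>(L, R). (\<lambda>a. star (R (star a)), \<lambda>a. star (L (star a)))"
  by (auto simp: double_centralizer_star)

instance
  by standard (transfer, auto)+

end

definition center :: "'a::times set"
  where "center = {z. \<forall>m. z * m = m * z}"

definition invertible_elt :: "'a::monoid_mult \<Rightarrow> bool"
  where "invertible_elt m \<longleftrightarrow> (\<exists>n. m * n = 1 \<and> n * m = 1)"


section \<open>Hilbert modules and their operators\<close>

text \<open>The norm of the carrier type is required to be the one induced by the inner product, so
  that completeness (class \<open>banach\<close>) refers to that norm.\<close>

locale hilbert_module =
  fixes act :: "'a::cstar_algebra \<Rightarrow> 'e::{complex_normed_vector,banach} \<Rightarrow> 'e"
    and ip :: "'e \<Rightarrow> 'e \<Rightarrow> 'a"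
  assumes act_add_left: "act (a + b) x = act a x + act b x"
    and act_add_right: "act a (x + y) = act a x + act a y"
    and act_mult: "act (a * b) x = act a (act b x)"
    and act_scaleC_left: "act (c *\<^sub>C a) x = c *\<^sub>C act a x"
    and act_scaleC_right: "act a (c *\<^sub>C x) = c *\<^sub>C act a x"
    and ip_add_left: "ip (x + y) z = ip x z + ip y z"
    and ip_scaleC_left: "ip (c *\<^sub>C x) y = c *\<^sub>C ip x y"
    and ip_act_left: "ip (act a x) y = a * ip x y"
    and star_ip: "star (ip x y) = ip y x"
    and ip_self_positive: "cpositive (ip x x)"
    and ip_self_eq_0_iff: "ip x x = 0 \<longleftrightarrow> x = 0"
    and norm_eq_sqrt_norm_ip: "norm x = sqrt (norm (ip x x))"

locale full_hilbert_module = hilbert_module +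
  assumes full: "closure (complex_vector.span {ip x y | x y. True}) = UNIV"

text \<open>The action of a multiplier on a Hilbert module is the unique bounded operator $f$ with
  $f(ax) = (ma)x$.\<close>

definition mult_act ::
    "('a::cstar_algebra \<Rightarrow> 'e::{complex_normed_vector,banach} \<Rightarrow> 'e) \<Rightarrow> 'a multiplier \<Rightarrow> 'e \<Rightarrow> 'e"
  where "mult_act act m =
    (THE f. clinear f \<and> bounded_linear f \<and> (\<forall>a x. f (act a x) = act (lmul m a) x))"

definition module_linear :: "('a \<Rightarrow> 'e::complex_vector \<Rightarrow> 'e) \<Rightarrow> ('e \<Rightarrow> 'e) \<Rightarrow> bool"
  where "module_linear act T \<longleftrightarrow> clinear T \<and> (\<forall>a x. T (act a x) = act a (T x))"

definition is_adjoint :: "('e \<Rightarrow> 'e \<Rightarrow> 'a) \<Rightarrow> ('e \<Rightarrow> 'e) \<Rightarrow> ('e \<Rightarrow> 'e) \<Rightarrow> bool"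
  where "is_adjoint ip T T' \<longleftrightarrow> (\<forall>x y. ip (T x) y = ip x (T' y))"

definition adjointable :: "('e \<Rightarrow> 'e \<Rightarrow> 'a) \<Rightarrow> ('e \<Rightarrow> 'e) \<Rightarrow> bool"
  where "adjointable ip T \<longleftrightarrow> (\<exists>T'. is_adjoint ip T T')"

definition op_adjoint :: "('e \<Rightarrow> 'e \<Rightarrow> 'a) \<Rightarrow> ('e \<Rightarrow> 'e) \<Rightarrow> 'e \<Rightarrow> 'e"
  where "op_adjoint ip T = (THE T'. is_adjoint ip T T')"

definition unitary_operator :: "('e \<Rightarrow> 'e \<Rightarrow> 'a) \<Rightarrow> ('e \<Rightarrow> 'e) \<Rightarrow> bool"
  where "unitary_operator ip U \<longleftrightarrow>
    adjointable ip U \<and> op_adjoint ip U \<circ> U = id \<and> U \<circ> op_adjoint ip U = id"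

end

theory Submission
  imports Defs
begin

text \<open>
  The hypothesis says that \<open>T\<close> has the adjoint \<open>T\<^sup>* = \<gamma>\<^sup>* S\<^sup>-\<^sup>1\<close>. This map is bounded, so \<open>T\<close> is bounded
  and, like every adjointable map, \<open>\<A>\<close>-linear; \<open>S\<close> is bounded because it inverts a bounded bijection
  of Banach spaces. All further claims about the pair follow from these formulas as soon as \<open>T\<close> is
  bijective, for then \<open>S\<^sup>* = \<gamma> T\<^sup>-\<^sup>1\<close>. Injectivity is immediate. Surjectivity is the delicate point, as a
  closed submodule of a Hilbert module need not be complemented: a trivial orthogonal complement of the
  range proves nothing. But \<open>T\<^sup>*\<close> is bounded below, so the self-adjoint operator \<open>Q = T T\<^sup>*\<close> is bounded
  below too, and a self-adjoint operator that is bounded below is invertible. Indeed \<open>Q + i r\<close> is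
  invertible for large \<open>r\<close>, stays invertible while \<open>r\<close> decreases because it is bounded below by a
  multiple of \<open>r\<close>, and \<open>Q\<close> is reached by one last small perturbation
  (\<open>bounded_below_imp_adjoint_surj\<close>).

  For \<open>T = S\<close> put \<open>n = \<bar>\<gamma>\<bar> - \<gamma>\<close>, a central multiplier, and \<open>\<sigma> = \<bar>\<gamma>\<bar>\<^bsup>1/2\<^esup>\<close>. Then \<open>n \<gamma> n = - (\<sigma> n)\<^sup>2\<close>, hence
  \<open>\<langle>T n x, T n x\<rangle> + \<langle>\<sigma> n x, \<sigma> n x\<rangle> = 0\<close> for all \<open>x\<close>. A sum of two elements of the form \<open>b\<^sup>* b\<close> vanishes only if
  both do, so \<open>\<sigma> n\<close> acts as zero, which means \<open>\<sigma> n = 0\<close> on a full module, and \<open>\<gamma>\<close> is positive. Then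
  \<open>U = \<gamma>\<^bsup>-1/2\<^esup> T\<close> preserves the inner product and is bijective.

  The second part rests on positivity in \<open>C\<^sup>*\<close>-algebras: every \<open>b\<^sup>* b\<close> is the square of a self-adjoint
  element (\<open>nonneg_star_mult\<close>, due to Fukamiya, Kelley and Vaught), and positive square roots exist and
  are unique. The development avoids spectra. A self-adjoint \<open>a\<close> counts as positive if
  \<open>norm (t 1 - a) \<le> t\<close> for some \<open>t > 0\<close>; such elements visibly form a cone, and they are exactly the
  squares of self-adjoint elements, by an iteration for \<open>1 - sqrt (1 - x)\<close> that converges on the closed
  unit ball. All this takes place in a unital algebra. An arbitrary \<open>C\<^sup>*\<close>-algebra embeds into its
  multiplier algebra, which is shown to be a unital \<open>C\<^sup>*\<close>-algebra; this also gives the local left units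
  from which multipliers obtain their action on the module.
\<close>

section \<open>Square roots in $C^*$-algebras\<close>

lemma star_zero [simp]: "star (0::'a::cstar_algebra) = 0"
  using star_add[of "0::'a" 0] by simp

lemma star_minus: "star (- a) = - star (a::'a::cstar_algebra)"
  using star_add[of "- a" a] by (simp add: eq_neg_iff_add_eq_0)

lemma star_diff: "star (a - b) = star a - star (b::'a::cstar_algebra)"
  using star_add[of a "- b"] by (simp add: star_minus)

lemma star_scaleR: "star (r *\<^sub>R a) = r *\<^sub>R star (a::'a::cstar_algebra)"
  by (simp add: scaleR_scaleC star_scaleC)

lemma star_one [simp]: "star (1::'a::{cstar_algebra,monoid_mult}) = 1"
  by (metis mult_1_left mult_1_right star_mult star_star)

lemmas star_simps = star_add star_minus star_diff star_scaleR star_scaleC star_mult star_star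

lemma norm_star [simp]: "norm (star a) = norm (a::'a::cstar_algebra)"
proof -
  have le: "norm b \<le> norm (star b)" for b :: 'a
  proof (cases "b = 0")
    case False
    have "norm b * norm b \<le> norm (star b) * norm b"
      using norm_mult_ineq[of "star b" b] by (simp add: cstar_identity power2_eq_square)
    with False show ?thesis by simp
  qed simp
  from le[of a] le[of "star a"] show ?thesis by (simp add: star_star)
qed

lemma norm_mult_star: "norm (a * star a) = (norm (a::'a::cstar_algebra))\<^sup>2"
  using cstar_identity[of "star a"] by (simp add: star_star)

lemma star_mult_eq_0: "star a * a = 0 \<longleftrightarrow> a = (0::'a::cstar_algebra)"
  using cstar_identity[of a] by auto

lemma norm_square_selfadjoint: "star a = a \<Longrightarrow> norm (a * a) = (norm (a::'a::cstar_algebra))\<^sup>2"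
  using cstar_identity[of a] by simp

lemma norm_unit_le_1: "norm (1::'a::{cstar_algebra,monoid_mult}) \<le> 1"
proof -
  have "norm (1::'a) = (norm (1::'a))\<^sup>2"
    using cstar_identity[of "1::'a"] by simp
  then show ?thesis
    by (metis abs_norm_cancel dual_order.refl power2_eq_1_iff power_zero_numeral zero_le_one
        mult_cancel_right1 power2_eq_square)
qed

text \<open>This identity turns a sum of commuting squares into a single product \<open>b\<^sup>* b\<close>, to which the
  \<open>C\<^sup>*\<close>-identity applies; together with \<open>norm_cartesian_le\<close> it takes the place of monotonicity of the
  norm.\<close>

lemma star_mult_cartesian:
  fixes g h :: "'a::cstar_algebra"
  assumes "star g = g" "star h = h" "g * h = h * g"
  shows "star (g + \<i> *\<^sub>C h) * (g + \<i> *\<^sub>C h) = g * g + h * h"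
  using assms
  by (simp add: star_simps algebra_simps mult_scaleC_left mult_scaleC_right scaleC_scaleC
      complex_vector.scale_minus_left scaleC_one)

lemma norm_cartesian_le:
  fixes g h :: "'a::cstar_algebra"
  assumes "star g = g" "star h = h"
  shows "norm h \<le> norm (g + \<i> *\<^sub>C h)"
proof -
  let ?b = "g + \<i> *\<^sub>C h"
  have "?b - star ?b = (2 * \<i>) *\<^sub>C h"
    using assms by (simp add: star_simps complex_vector.scale_minus_left scaleC_add_left[symmetric])
  then have "2 * norm h = norm (?b - star ?b)"
    by (simp add: norm_scaleC norm_mult)
  also have "\<dots> \<le> norm ?b + norm (star ?b)" by (rule norm_triangle_ineq4)
  finally show ?thesis by simp
qed

text \<open>The limit solves \<open>2 f = x + f\<^sup>2\<close> and so is \<open>1 - sqrt (1 - x)\<close>. The iterates are polynomials in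
  \<open>x\<close> with nonnegative coefficients and no constant term, as are their successive differences. Hence
  the numerical iteration at \<open>x = 1\<close>, which is monotone and bounded by \<open>1\<close>, dominates the iteration on
  the whole closed unit ball.\<close>

primrec root_iter :: "'a::real_normed_algebra \<Rightarrow> nat \<Rightarrow> 'a" where
  "root_iter x 0 = 0"
| "root_iter x (Suc n) = (1/2) *\<^sub>R (x + root_iter x n * root_iter x n)"

lemma root_iter_one: "0 \<le> root_iter (1::real) n \<and> root_iter (1::real) n \<le> 1"
proof (induction n)
  case (Suc n)
  then have "root_iter (1::real) n * root_iter 1 n \<le> 1 * 1"
    by (intro mult_mono) auto
  with Suc show ?case by simp
qed simp

lemma norm_root_iter_le:
  assumes "norm x \<le> 1"
  shows "norm (root_iter x n) \<le> root_iter 1 n"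
proof (induction n)
  case (Suc n)
  have "norm (root_iter x n * root_iter x n) \<le> root_iter 1 n * root_iter 1 n"
    using Suc root_iter_one[of n]
    by (intro order_trans[OF norm_mult_ineq] mult_mono) auto
  with assms have "norm (x + root_iter x n * root_iter x n) \<le> 1 + root_iter 1 n * root_iter 1 n"
    by (intro order_trans[OF norm_triangle_ineq]) simp
  then show ?case by simp
qed simp

lemma norm_root_iter_diff_le:
  assumes "norm x \<le> 1"
  shows "norm (root_iter x (Suc n) - root_iter x n) \<le> root_iter 1 (Suc n) - root_iter 1 n"
proof (induction n)
  case 0
  then show ?case using assms by simp
next
  case (Suc n)
  define a b s t where "a = root_iter x (Suc n)" and "b = root_iter x n"
    and "s = root_iter (1::real) (Suc n)" and "t = root_iter (1::real) n"
  have IH: "norm (a - b) \<le> s - t" using Suc by (simp only: a_def b_def s_def t_def)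
  have ab: "norm a \<le> s" "norm b \<le> t"
    using norm_root_iter_le[OF assms] by (simp_all only: a_def b_def s_def t_def)
  have "a * a - b * b = a * (a - b) + (a - b) * b" by (simp add: algebra_simps)
  then have "norm (a * a - b * b) \<le> norm (a * (a - b)) + norm ((a - b) * b)"
    by (metis norm_triangle_ineq)
  also have "\<dots> \<le> s * (s - t) + (s - t) * t"
    using IH ab norm_ge_zero[of a] norm_ge_zero[of b] norm_ge_zero[of "a - b"]
    by (intro add_mono order_trans[OF norm_mult_ineq] mult_mono) linarith+
  finally have le: "norm (a * a - b * b) \<le> s * s - t * t" by (simp add: algebra_simps)
  have "root_iter x (Suc (Suc n)) - root_iter x (Suc n) = (1/2) *\<^sub>R (a * a - b * b)"
    unfolding root_iter.simps(2)[of x "Suc n"] a_def[symmetric]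
    by (simp add: a_def b_def scaleR_diff_right[symmetric])
  moreover have "root_iter (1::real) (Suc (Suc n)) - root_iter 1 (Suc n) = (1/2) * (s * s - t * t)"
    unfolding root_iter.simps(2)[of 1 "Suc n"] s_def[symmetric]
    by (simp add: s_def t_def field_simps)
  ultimately show ?case using le by simp
qed

lemma root_iter_convergent:
  fixes x :: "'a::{real_normed_algebra,banach}"
  assumes "norm x \<le> 1"
  shows "convergent (root_iter x)"
proof -
  have "incseq (root_iter (1::real))"
    using order_trans[OF norm_ge_zero norm_root_iter_diff_le[of "1::real"]]
    by (intro incseq_SucI) simp
  moreover have "bdd_above (range (root_iter (1::real)))"
    using root_iter_one by (meson bdd_aboveI2)
  ultimately have "root_iter (1::real) \<longlonglongrightarrow> (SUP n. root_iter 1 n)"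
    using LIMSEQ_incseq_SUP by blast
  then have "summable (\<lambda>n. root_iter (1::real) (Suc n) - root_iter 1 n)"
    by (rule telescope_summable)
  then have "summable (\<lambda>n. root_iter x (Suc n) - root_iter x n)"
    by (rule summable_comparison_test'[where N = 0])
      (use norm_root_iter_diff_le[OF assms] in blast)
  then have "convergent (\<lambda>n. \<Sum>i<n. root_iter x (Suc i) - root_iter x i)"
    using summable_iff_convergent by blast
  then show ?thesis by (simp only: sum_lessThan_telescope root_iter.simps(1) diff_zero)
qed

lemma root_equation_solvable:
  fixes x :: "'a::cstar_algebra"
  assumes x: "norm x \<le> 1" "star x = x"
  obtains f where "star f = f" "norm f \<le> 1" "2 *\<^sub>R f = x + f * f"
    "\<And>y. x * y = y * x \<Longrightarrow> f * y = y * f"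
proof -
  from root_iter_convergent[OF x(1)] obtain f where f: "root_iter x \<longlonglongrightarrow> f"
    by (auto simp: convergent_def)
  have "star (root_iter x n) = root_iter x n" for n
    by (induction n) (simp_all add: star_simps x)
  moreover have "(\<lambda>n. star (root_iter x n)) \<longlonglongrightarrow> star f"
    by (rule bounded_linear.tendsto[OF star_bounded_linear f])
  ultimately have "star f = f" using f LIMSEQ_unique by fastforce
  moreover have "norm f \<le> 1"
    using norm_root_iter_le[OF x(1)] root_iter_one
    by (intro LIMSEQ_le_const2[OF tendsto_norm[OF f]]) (meson order_trans)
  moreover have "2 *\<^sub>R f = x + f * f"
  proof -
    have "(\<lambda>n. root_iter x (Suc n)) \<longlonglongrightarrow> (1/2) *\<^sub>R (x + f * f)"
      unfolding root_iter.simps by (intro tendsto_intros f)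
    then have "f = (1/2) *\<^sub>R (x + f * f)"
      using LIMSEQ_unique LIMSEQ_Suc[OF f] by blast
    then have "2 *\<^sub>R f = 2 *\<^sub>R ((1/2) *\<^sub>R (x + f * f))" by (rule arg_cong)
    then show ?thesis by simp
  qed
  moreover have "f * y = y * f" if y: "x * y = y * x" for y
  proof -
    have "root_iter x n * y = y * root_iter x n" for n
    proof (induction n)
      case (Suc n)
      have "root_iter x n * root_iter x n * y = y * (root_iter x n * root_iter x n)"
        by (metis Suc mult.assoc)
      then show ?case by (simp add: algebra_simps y)
    qed simp
    moreover have "(\<lambda>n. root_iter x n * y) \<longlonglongrightarrow> f * y" "(\<lambda>n. y * root_iter x n) \<longlonglongrightarrow> y * f"
      by (intro tendsto_intros f)+
    ultimately show ?thesis using LIMSEQ_unique by fastforce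
  qed
  ultimately show ?thesis using that by blast
qed

section \<open>Positivity in unital $C^*$-algebras\<close>

text \<open>For self-adjoint \<open>a\<close> the condition \<open>norm (t 1 - a) \<le> t\<close> says that the spectrum of \<open>a\<close> lies in
  \<open>[0, 2 t]\<close>. In this form sums are harmless, because the conditions for two summands add up.\<close>

definition nonneg :: "'a::{cstar_algebra,monoid_mult} \<Rightarrow> bool"
  where "nonneg a \<longleftrightarrow> star a = a \<and> (\<exists>t>0. norm (t *\<^sub>R 1 - a) \<le> t)"

lemma nonneg_scaleR:
  assumes "nonneg a" "0 < r"
  shows "nonneg (r *\<^sub>R a)"
proof -
  from assms obtain t where t: "star a = a" "0 < t" "norm (t *\<^sub>R 1 - a) \<le> t"
    by (auto simp: nonneg_def)
  have "(r * t) *\<^sub>R 1 - r *\<^sub>R a = r *\<^sub>R (t *\<^sub>R 1 - a)" by (simp add: scaleR_diff_right)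
  with t assms have "norm ((r * t) *\<^sub>R 1 - r *\<^sub>R a) \<le> r * t" by simp
  moreover have "0 < r * t" using t assms by simp
  ultimately show ?thesis using t unfolding nonneg_def by (auto simp: star_simps)
qed

lemma nonneg_add:
  assumes "nonneg a" "nonneg b"
  shows "nonneg (a + b)"
proof -
  from assms obtain s t where st: "0 < s" "norm (s *\<^sub>R 1 - a) \<le> s" "0 < t" "norm (t *\<^sub>R 1 - b) \<le> t"
    "star a = a" "star b = b"
    by (auto simp: nonneg_def)
  have "(s + t) *\<^sub>R 1 - (a + b) = (s *\<^sub>R 1 - a) + (t *\<^sub>R 1 - b)" by (simp add: algebra_simps)
  then have "norm ((s + t) *\<^sub>R 1 - (a + b)) \<le> s + t"
    using norm_triangle_ineq[of "s *\<^sub>R 1 - a" "t *\<^sub>R 1 - b"] st(2,4)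
    by (simp only:)
  with st show ?thesis unfolding nonneg_def
    by (intro conjI exI[of _ "s + t"]) (auto simp: star_simps)
qed

lemma sqrt_one_minus:
  fixes x :: "'a::{cstar_algebra,monoid_mult}"
  assumes "norm x \<le> 1" "star x = x"
  obtains g where "star g = g" "g * g = 1 - x" "norm (1 - g) \<le> 1"
    "\<And>y. x * y = y * x \<Longrightarrow> g * y = y * g"
proof -
  from root_equation_solvable[OF assms] obtain f where f: "star f = f" "norm f \<le> 1"
    "2 *\<^sub>R f = x + f * f" "\<And>y. x * y = y * x \<Longrightarrow> f * y = y * f" by metis
  show thesis
  proof
    show "star (1 - f) = 1 - f" using f(1) by (simp add: star_simps)
    have "(1 - f) * (1 - f) = 1 - 2 *\<^sub>R f + f * f" by (simp add: algebra_simps scaleR_2)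
    then show "(1 - f) * (1 - f) = 1 - x" using f(3) by simp
    show "norm (1 - (1 - f)) \<le> 1" using f(2) by simp
    show "(1 - f) * y = y * (1 - f)" if "x * y = y * x" for y
      using f(4)[OF that] by (simp add: left_diff_distrib right_diff_distrib)
  qed
qed

lemma nonneg_sqrt:
  assumes "nonneg a"
  obtains h where "nonneg h" "star h = h" "h * h = a" "\<And>y. a * y = y * a \<Longrightarrow> h * y = y * h"
proof -
  from assms obtain t where t: "star a = a" "0 < t" "norm (t *\<^sub>R 1 - a) \<le> t"
    by (auto simp: nonneg_def)
  define x where "x = (1 - (1/t) *\<^sub>R a)"
  have "x = (1/t) *\<^sub>R (t *\<^sub>R 1 - a)" using t by (simp add: x_def scaleR_diff_right)
  then have "norm x \<le> 1" using t by (simp del: scaleR_diff_right)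
  moreover have "star x = x" using t by (simp add: x_def star_simps)
  ultimately obtain g where g: "star g = g" "g * g = 1 - x" "norm (1 - g) \<le> 1"
    "\<And>y. x * y = y * x \<Longrightarrow> g * y = y * g"
    by (rule sqrt_one_minus) blast
  define h where "h = sqrt t *\<^sub>R g"
  have st: "star h = h" using g(1) by (simp add: h_def star_simps)
  have "h * h = a" using t g(2) by (simp add: h_def x_def)
  moreover have "h * y = y * h" if "a * y = y * a" for y
    using g(4)[of y] that by (simp add: h_def x_def algebra_simps)
  moreover have "sqrt t *\<^sub>R 1 - h = sqrt t *\<^sub>R (1 - g)" by (simp add: h_def scaleR_diff_right)
  then have "norm (sqrt t *\<^sub>R 1 - h) \<le> sqrt t"
    using t g(3) by (simp add: mult_left_le)
  then have "nonneg h" using t st by (auto simp: nonneg_def intro!: exI[of _ "sqrt t"])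
  ultimately show thesis using st that by blast
qed

text \<open>Every self-adjoint contraction \<open>h\<close> is the imaginary part of a unitary, namely of
  \<open>u = sqrt (1 - h\<^sup>2) + i h\<close>, and \<open>1 - h\<^sup>2\<close> is a trigonometric polynomial in \<open>u\<close> with nonnegative
  coefficients that sum to \<open>1\<close>.\<close>

lemma norm_one_minus_square_le:
  fixes h :: "'a::{cstar_algebra,monoid_mult}"
  assumes h: "star h = h" "norm h \<le> 1"
  shows "norm (1 - h * h) \<le> 1"
proof -
  have "norm (h * h) \<le> 1" using h by (simp add: norm_square_selfadjoint power_le_one)
  moreover have "star (h * h) = h * h" using h by (simp add: star_mult)
  ultimately obtain g where g: "star g = g" "g * g = 1 - h * h"
    "\<And>y. h * h * y = y * (h * h) \<Longrightarrow> g * y = y * g"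
    by (rule sqrt_one_minus) blast
  have gh: "g * h = h * g" using g(3)[of h] by (simp add: mult.assoc)
  define u where "u = g + \<i> *\<^sub>C h"
  have "star u * u = 1"
    unfolding u_def by (subst star_mult_cartesian) (use g(1,2) h gh in auto)
  then have "(norm u)\<^sup>2 \<le> 1" using cstar_identity[of u] norm_unit_le_1[where 'a = 'a] by simp
  then have u: "norm u \<le> 1" by (simp add: power_le_one_iff abs_square_le_1)
  \<comment> \<open>The function \<open>1 - (sin \<theta>)\<^sup>2 = (2 + e\<^bsup>2 i \<theta>\<^esup> + e\<^bsup>- 2 i \<theta>\<^esup>) / 4\<close> at the unitary \<open>u = e\<^bsup>i \<theta>\<^esup>\<close>.\<close>
  have "u * u + star u * star u = 2 *\<^sub>R (g * g - h * h)"
    using g(1) h gh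
    by (simp add: u_def star_simps algebra_simps mult_scaleC_left mult_scaleC_right scaleC_scaleC
        complex_vector.scale_minus_left scaleC_one scaleR_2)
  then have "2 *\<^sub>R 1 + (u * u + star u * star u) = 4 *\<^sub>R (1 - h * h)"
    using scaleR_add_left[of 2 2 "1::'a"] scaleR_add_left[of 2 2 "h * h"] unfolding g(2) by (simp add: algebra_simps)
  then have "1 - h * h = (1/4) *\<^sub>R (2 *\<^sub>R 1 + (u * u + star u * star u))"
    by (simp only: scaleR_scaleR) simp
  moreover have "norm (2 *\<^sub>R 1 + (u * u + star u * star u)) \<le> 2 + (1 + 1)"
  proof -
    have *: "norm (v * v) \<le> 1" if "norm v \<le> 1" for v :: 'a
      using norm_mult_ineq[of v v] that by (meson mult_le_one norm_ge_zero order_trans)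
    have "norm (u * u) \<le> 1" "norm (star u * star u) \<le> 1" "norm (2 *\<^sub>R (1::'a)) \<le> 2"
      using *[of u] *[of "star u"] u norm_unit_le_1[where 'a = 'a] by auto
    then show ?thesis
      by (intro order_trans[OF norm_triangle_ineq] add_mono)
  qed
  ultimately show ?thesis by simp
qed

lemma nonneg_square:
  assumes "star h = h"
  shows "nonneg (h * h)"
proof -
  define r where "r = norm h + 1"
  have r: "r > 0" by (simp add: r_def add_nonneg_pos)
  define k where "k = (1/r) *\<^sub>R h"
  have "norm k \<le> 1" using r by (simp add: k_def r_def)
  moreover have "star k = k" using assms by (simp add: k_def star_simps)
  ultimately have "nonneg (k * k)"
    using norm_one_minus_square_le[of k]
    unfolding nonneg_def by (auto simp: star_simps intro!: exI[of _ 1])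
  then have "nonneg ((r * r) *\<^sub>R (k * k))" using r by (intro nonneg_scaleR) auto
  then show ?thesis using r by (simp add: k_def)
qed

text \<open>If \<open>a = h\<^sup>2\<close> and \<open>- a = g\<^sup>2\<close> with commuting self-adjoint roots, then \<open>(g + i h)\<^sup>* (g + i h) = 0\<close>. The
  roots can be taken to commute since \<open>h\<close> is a limit of polynomials in \<open>a\<close>.\<close>

lemma nonneg_antisym:
  assumes "nonneg a" "nonneg (- a)"
  shows "a = 0"
proof -
  from nonneg_sqrt[OF assms(1)] obtain h where h: "star h = h" "h * h = a"
    "\<And>y. a * y = y * a \<Longrightarrow> h * y = y * h" by metis
  from nonneg_sqrt[OF assms(2)] obtain g where g: "star g = g" "g * g = - a"
    by metis
  have "a * g = g * a" using g(2) by (metis minus_mult_minus minus_minus mult.assoc mult_minus_left mult_minus_right)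
  then have gh: "g * h = h * g" using h(3)[of g] by simp
  have "star (g + \<i> *\<^sub>C h) * (g + \<i> *\<^sub>C h) = 0"
    using star_mult_cartesian[OF g(1) h(1) gh] g(2) h(2) by simp
  then have "norm h \<le> 0"
    using norm_cartesian_le[OF g(1) h(1)] by (simp add: star_mult_eq_0)
  then show ?thesis using h(2) by auto
qed

text \<open>If \<open>1 + x\<^sup>* x\<close> is a contraction, then the powers of \<open>1 + x x\<^sup>*\<close> are \<open>1 + x G\<^sub>n x\<^sup>*\<close> with \<open>norm G\<^sub>n \<le> n\<close> and so grow linearly at most,
  while the norms of the powers \<open>2\<^sup>m\<close> of a self-adjoint element grow exponentially as soon as its
  norm exceeds \<open>1\<close>. This stands in for the fact that \<open>x x\<^sup>*\<close> and \<open>x\<^sup>* x\<close> have the same nonzero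
  spectrum.\<close>

lemma norm_one_plus_flip:
  fixes x :: "'a::{cstar_algebra,monoid_mult}"
  assumes x: "norm (1 + star x * x) \<le> 1"
  shows "norm (1 + x * star x) \<le> 1"
proof (rule ccontr)
  define c where "c = 1 + x * star x"
  assume "\<not> norm (1 + x * star x) \<le> 1"
  then have c1: "norm c > 1" by (simp add: c_def)
  then have c0: "c \<noteq> 0" by auto
  have "\<exists>G. norm G \<le> real n \<and> c ^ n = 1 + x * G * star x" for n
  proof (induction n)
    case 0
    show ?case by (intro exI[of _ 0]) simp
  next
    case (Suc n)
    then obtain G where G: "norm G \<le> real n" "c ^ n = 1 + x * G * star x" by blast
    have "norm ((1 + star x * x) * G) \<le> 1 * real n"
      by (rule order_trans[OF norm_mult_ineq mult_mono[OF x G(1)]]) auto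
    then have "norm ((1 + star x * x) * G + 1) \<le> 1 * real n + 1"
      by (intro order_trans[OF norm_triangle_ineq] add_mono norm_unit_le_1)
    moreover have "c ^ Suc n = 1 + x * ((1 + star x * x) * G + 1) * star x"
      unfolding power_Suc G(2) by (simp add: c_def algebra_simps)
    ultimately show ?case by (intro exI[of _ "(1 + star x * x) * G + 1"]) simp
  qed
  note lin = this
  have "star c = c" by (simp add: c_def star_simps)
  then have sc: "star (c ^ n) = c ^ n" for n
    by (induction n) (simp_all add: star_mult power_commutes)
  have dbl: "norm (c ^ (2 ^ m)) = norm c ^ (2 ^ m)" for m
  proof (induction m)
    case (Suc m)
    have "c ^ (2 ^ Suc m) = c ^ (2 ^ m) * c ^ (2 ^ m)" by (simp add: mult_2 power_add)
    then show ?case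
      using norm_square_selfadjoint[OF sc[of "2 ^ m"]] Suc
      by (simp add: power_mult[symmetric] mult.commute)
  qed simp
  define C where "C = norm x * norm x"
  have bound: "norm c ^ (2 ^ m) \<le> 1 + C * 2 ^ m" for m
  proof -
    obtain G where G: "norm G \<le> real (2 ^ m)" "c ^ (2 ^ m) = 1 + x * G * star x"
      using lin by blast
    have "norm (x * G * star x) \<le> norm x * real (2 ^ m) * norm x"
      using G(1) by (intro order_trans[OF norm_mult_ineq] mult_mono) auto
    then have "norm (c ^ (2 ^ m)) \<le> 1 + norm x * real (2 ^ m) * norm x"
      unfolding G(2) using norm_unit_le_1[where 'a = 'a]
      by (intro order_trans[OF norm_triangle_ineq] add_mono)
    then show ?thesis unfolding dbl C_def by (simp add: mult_ac)
  qed
  have "filterlim (\<lambda>n. norm c ^ n / real n) at_top sequentially"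
  proof -
    have "(\<lambda>n. real n * (1 / norm c) ^ n) \<longlonglongrightarrow> 0"
      by (rule powser_times_n_limit_0) (use c1 in \<open>simp add: divide_less_eq\<close>)
    moreover have "eventually (\<lambda>n. real n * (1 / norm c) ^ n > 0) sequentially"
      using c0 by (intro eventually_sequentiallyI[of 1]) simp
    ultimately have "filterlim (\<lambda>n. inverse (real n * (1 / norm c) ^ n)) at_top sequentially"
      by (rule filterlim_inverse_at_top)
    then show ?thesis by (simp add: field_simps)
  qed
  then have "eventually (\<lambda>n. norm c ^ n / real n > 1 + C) sequentially"
    by (simp add: filterlim_at_top_dense)
  then obtain N where N: "\<And>n. n \<ge> N \<Longrightarrow> norm c ^ n / real n > 1 + C"
    by (auto simp: eventually_sequentially)
  have "N \<le> 2 ^ N" using less_exp[of N] by simp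
  from N[OF this] have "norm c ^ (2 ^ N) > (1 + C) * 2 ^ N"
    by (simp add: field_simps)
  moreover have "(1 + C) * 2 ^ N \<ge> 1 + C * (2 ^ N)" by (simp add: algebra_simps)
  ultimately show False using bound[of N] by simp
qed

lemma nonneg_minus_flip:
  assumes "nonneg (- (star x * x))"
  shows "nonneg (- (x * star x))"
proof -
  from assms obtain t where t: "t > 0" "norm (t *\<^sub>R 1 + star x * x) \<le> t"
    by (auto simp: nonneg_def)
  define y where "y = (1 / sqrt t) *\<^sub>R x"
  have y: "star y * y = (1/t) *\<^sub>R (star x * x)" "y * star y = (1/t) *\<^sub>R (x * star x)"
    using t by (simp_all add: y_def star_simps flip: real_sqrt_mult)
  have e: "1 + star y * y = (1/t) *\<^sub>R (t *\<^sub>R 1 + star x * x)"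
    "t *\<^sub>R 1 + x * star x = t *\<^sub>R (1 + y * star y)"
    using t by (simp_all add: y scaleR_add_right)
  have "norm (1 + star y * y) \<le> 1" using t by (simp only: e norm_scaleR) simp
  then have "norm (1 + y * star y) \<le> 1" by (rule norm_one_plus_flip)
  then have "norm (t *\<^sub>R 1 + x * star x) \<le> t" using t by (simp only: e norm_scaleR) (simp add: mult_left_le)
  with t show ?thesis by (auto simp: nonneg_def star_simps)
qed

text \<open>With the Cartesian decomposition \<open>x = h + i k\<close>, the sum \<open>x\<^sup>* x + x x\<^sup>* = 2 (h\<^sup>2 + k\<^sup>2)\<close> is positive. If
  \<open>x\<^sup>* x\<close> were negative, then so would be \<open>x x\<^sup>*\<close>, by the flip; subtracting, \<open>x x\<^sup>*\<close> would be positive as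
  well.\<close>

lemma nonneg_minus_star_mult_imp_0:
  fixes x :: "'a::{cstar_algebra,monoid_mult}"
  assumes "nonneg (- (star x * x))"
  shows "x = 0"
proof -
  define h k where "h = (1/2) *\<^sub>R (x + star x)" and "k = (- \<i> / 2) *\<^sub>C (x - star x)"
  have hk: "star h = h" "star k = k"
    by (simp_all add: h_def k_def star_simps complex_vector.scale_right_diff_distrib
        complex_vector.scale_minus_left)
  have "h * h = (1/4) *\<^sub>R (x * x + x * star x + star x * x + star x * star x)"
    by (simp add: h_def algebra_simps)
  then have hh: "h * h = (1/4) *\<^sub>R ((x * x + star x * star x) + (star x * x + x * star x))"
    by (simp add: add_ac)
  have "k * k = (- (1/4)) *\<^sub>R (x * x - x * star x - star x * x + star x * star x)"
    by (simp add: k_def mult_scaleC_left mult_scaleC_right scaleC_scaleC scaleR_scaleC algebra_simps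
        complex_vector.scale_minus_left)
  then have kk: "k * k = (- (1/4)) *\<^sub>R ((x * x + star x * star x) - (star x * x + x * star x))"
    by (simp only: diff_conv_add_uminus minus_add add_ac)
  have "2 *\<^sub>R ((1/4) *\<^sub>R (a + b) + (- (1/4)) *\<^sub>R (a - b)) = b" for a b :: 'a
    using scaleR_add_left[of "1/2" "1/2" b] by (simp add: algebra_simps)
  then have sum: "2 *\<^sub>R (h * h + k * k) = star x * x + x * star x"
    unfolding hh kk .
  have "nonneg (2 *\<^sub>R (h * h + k * k))"
    by (intro nonneg_scaleR nonneg_add nonneg_square hk) simp
  then have "nonneg (- (star x * x) + 2 *\<^sub>R (h * h + k * k))" "nonneg (- (x * star x))"
    using nonneg_add[OF assms] nonneg_minus_flip[OF assms] by blast+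
  then have "nonneg (x * star x)" "nonneg (- (x * star x))"
    unfolding sum by simp_all
  then have "x * star x = 0" by (rule nonneg_antisym)
  then show ?thesis using norm_mult_star[of x] by simp
qed

text \<open>Here \<open>n = \<bar>a\<bar> - a\<close> is twice the negative part of \<open>a\<close>, and \<open>\<sigma> = \<bar>a\<bar>\<^bsup>1/2\<^esup>\<close>. Both are limits of polynomials
  in \<open>a\<close>, whence the commutation properties. Positivity of \<open>a\<close> can thus be tested on the range of
  \<open>n\<close>, where \<open>a\<close> is as negative as it can be: its compression is minus a square.\<close>

lemma negative_part:
  fixes a :: "'a::{cstar_algebra,monoid_mult}"
  assumes a: "star a = a"
  obtains n \<sigma> where "star n = n" "star \<sigma> = \<sigma>" "\<sigma> * n = n * \<sigma>" "n * a * n = - (\<sigma> * n * (\<sigma> * n))"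
    "\<And>y. a * y = y * a \<Longrightarrow> n * y = y * n" "\<And>y. a * y = y * a \<Longrightarrow> \<sigma> * y = y * \<sigma>"
    "\<sigma> * n = 0 \<Longrightarrow> nonneg a"
proof -
  from nonneg_sqrt[OF nonneg_square[OF a]] obtain d where d: "nonneg d" "star d = d" "d * d = a * a"
    "\<And>y. a * a * y = y * (a * a) \<Longrightarrow> d * y = y * d" by metis
  from nonneg_sqrt[OF d(1)] obtain s where s: "star s = s" "s * s = d"
    "\<And>y. d * y = y * d \<Longrightarrow> s * y = y * s" by metis
  have dc: "d * y = y * d" if "a * y = y * a" for y
    using that by (intro d(4)) (metis mult.assoc)
  have sc: "s * y = y * s" if "a * y = y * a" for y
    using dc[OF that] by (rule s(3))
  have da: "d * a = a * d" by (rule dc) simp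
  define n where "n = d - a"
  have nc: "n * y = y * n" if "a * y = y * a" for y
    using dc[OF that] that by (simp add: n_def algebra_simps)
  have na: "n * a = a * n" by (rule nc) simp
  have sn: "s * n = n * s"
    by (rule sc[OF na[symmetric]])
  have an: "a * n = - (d * n)"
    by (simp add: n_def algebra_simps d(3) da)
  have nan: "n * a * n = - (s * n * (s * n))"
  proof -
    have "n * a * n = - (n * (d * n))" by (simp add: mult.assoc an)
    also have "n * (d * n) = s * n * (s * n)"
      by (metis s(2) sn mult.assoc)
    finally show ?thesis .
  qed
  show thesis
  proof (rule that[of n s])
    show "star n = n" using a d(2) by (simp add: n_def star_simps)
    show "nonneg a" if "s * n = 0"
    proof -
      have dn: "d * n = 0" using that s(2) by (metis mult.assoc mult_zero_right)
      then have "a * n = 0" using an by simp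
      then have "n * n = 0" using dn by (simp add: n_def algebra_simps)
      then have "n = 0" using star_mult_eq_0[of n] a d(2) by (simp add: n_def star_simps)
      then show ?thesis using d(1) by (simp add: n_def)
    qed
  qed (fact s(1) sn nan nc sc)+
qed

text \<open>For \<open>a = b\<^sup>* b\<close> the compression \<open>n a n\<close> equals \<open>(b n)\<^sup>* (b n)\<close>, and it is minus a square; therefore
  \<open>b n = 0\<close>.\<close>

theorem nonneg_star_mult:
  fixes b :: "'a::{cstar_algebra,monoid_mult}"
  shows "nonneg (star b * b)"
proof -
  define a where "a = star b * b"
  have "star a = a" by (simp add: a_def star_simps)
  then obtain n s where ns: "star n = n" "star s = s" "s * n = n * s"
    "n * a * n = - (s * n * (s * n))" "s * n = 0 \<Longrightarrow> nonneg a" by (rule negative_part) blast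
  have "- (star (b * n) * (b * n)) = s * n * (s * n)"
    using ns(1,4) by (simp add: star_simps a_def mult.assoc)
  then have "nonneg (- (star (b * n) * (b * n)))"
    using nonneg_square[of "s * n"] ns by (simp add: star_simps)
  then have "b * n = 0" by (rule nonneg_minus_star_mult_imp_0)
  then have "n * a * n = 0" by (simp add: a_def mult.assoc)
  then have "s * n * (s * n) = 0" using ns(4) by simp
  then have "s * n = 0" using star_mult_eq_0[of "s * n"] ns by (simp add: star_simps)
  then show ?thesis using ns(5) by (simp add: a_def)
qed

lemma star_mult_add_eq_0:
  fixes x y :: "'a::{cstar_algebra,monoid_mult}"
  assumes "star x * x + star y * y = 0"
  shows "x = 0"
proof -
  have "- (star x * x) = star y * y" using assms by (simp add: minus_unique)
  then show ?thesis using nonneg_star_mult[of y] by (intro nonneg_minus_star_mult_imp_0) simp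
qed

lemma cpositive_iff_nonneg: "cpositive a \<longleftrightarrow> nonneg (a :: 'a::{cstar_algebra,monoid_mult})"
  unfolding cpositive_def using nonneg_star_mult nonneg_sqrt[of a] by metis

text \<open>The difference \<open>d = r - s\<close> satisfies \<open>d (r + s) d = 0\<close>, a sum of two positive elements.\<close>

theorem positive_sqrt_unique:
  fixes r s :: "'a::{cstar_algebra,monoid_mult}"
  assumes "nonneg r" "nonneg s" "r * r = s * s" "r * s = s * r"
  shows "r = s"
proof -
  from nonneg_sqrt[OF assms(1)] obtain b where b: "star b = b" "b * b = r" by metis
  from nonneg_sqrt[OF assms(2)] obtain c where c: "star c = c" "c * c = s" by metis
  define d where "d = r - s"
  have sd: "star d = d" using assms by (simp add: d_def nonneg_def star_simps)
  have "d * (r + s) = 0" using assms by (simp add: d_def algebra_simps)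
  then have "d * r * d + d * s * d = 0" by (simp add: distrib_left distrib_right flip: distrib_right)
  moreover have "d * r * d = star (b * d) * (b * d)" "d * s * d = star (c * d) * (c * d)"
    by (simp_all add: star_simps b c sd mult.assoc flip: b(2) c(2))
  ultimately have "star (b * d) * (b * d) + star (c * d) * (c * d) = 0"
    "star (c * d) * (c * d) + star (b * d) * (b * d) = 0" by (simp_all add: add.commute)
  then have "b * d = 0" "c * d = 0" using star_mult_add_eq_0 by blast+
  then have "r * d = 0" "s * d = 0" by (simp_all add: mult.assoc flip: b(2) c(2))
  then have "d * d = 0" by (simp add: d_def left_diff_distrib)
  then have "d = 0" using star_mult_eq_0[of d] sd by simp
  then show ?thesis by (simp add: d_def)
qed

theorem pos_sqrt_properties:
  fixes a :: "'a::{cstar_algebra,monoid_mult}"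
  assumes "cpositive a"
  shows "cpositive (pos_sqrt a)" "pos_sqrt a * pos_sqrt a = a"
    "a * y = y * a \<Longrightarrow> pos_sqrt a * y = y * pos_sqrt a"
proof -
  from assms have "nonneg a" by (simp add: cpositive_iff_nonneg)
  then obtain h where h: "nonneg h" "h * h = a" "\<And>y. a * y = y * a \<Longrightarrow> h * y = y * h"
    by (rule nonneg_sqrt) blast
  have "pos_sqrt a = h"
    unfolding pos_sqrt_def
  proof (rule the_equality)
    show "cpositive h \<and> h * h = a" using h(1,2) by (simp add: cpositive_iff_nonneg)
    fix r assume r: "cpositive r \<and> r * r = a"
    then have "nonneg r" and rr: "r * r = a" by (simp_all add: cpositive_iff_nonneg)
    have "h * r = r * h" by (rule h(3)) (simp add: mult.assoc flip: rr)
    show "r = h"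
      by (rule positive_sqrt_unique[OF \<open>nonneg r\<close> h(1)])
        (simp_all only: rr h(2) \<open>h * r = r * h\<close>)
  qed
  then show "cpositive (pos_sqrt a)" "pos_sqrt a * pos_sqrt a = a"
    "a * y = y * a \<Longrightarrow> pos_sqrt a * y = y * pos_sqrt a"
    using h(1,2) h(3)[of y] by (simp_all only: cpositive_iff_nonneg)
qed

section \<open>Approximate left units\<close>

lemma one_minus_invertible:
  fixes x :: "'a::{cstar_algebra,monoid_mult}"
  assumes x: "norm x < 1"
  obtains w where "w * (1 - x) = 1" "(1 - x) * w = 1"
proof -
  have "norm (x * a - x * b) \<le> norm x * norm (a - b)" "norm (a * x - b * x) \<le> norm x * norm (a - b)"
    for a b
    using norm_mult_ineq[of x "a - b"] norm_mult_ineq[of "a - b" x]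
    by (simp_all add: right_diff_distrib left_diff_distrib mult.commute)
  then have "\<exists>!w. 1 + x * w = w" "\<exists>!w. 1 + w * x = w"
    using x by (intro banach_fix_type[of "norm x"]; simp add: dist_norm)+
  then obtain v w where "1 + x * w = w" "1 + v * x = v" by blast
  then have vw: "(1 - x) * w = 1" "v * (1 - x) = 1"
    by (simp_all add: left_diff_distrib right_diff_distrib diff_eq_eq)
  then have "v = w" by (metis mult.assoc mult_1_left mult_1_right)
  with vw that show ?thesis by blast
qed

text \<open>For \<open>h = b b\<^sup>*\<close> let \<open>w\<close> be the inverse of \<open>h + e\<^sup>2\<close>. Then \<open>b - w h b = e\<^sup>2 w b\<close> has norm
  \<open>e\<^sup>2 norm (h\<^bsup>1/2\<^esup> w)\<close>. This is at most \<open>e / 2\<close>, because \<open>2 e h\<^bsup>1/2\<^esup> w\<close> is the imaginary part of the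
  unitary Cayley transform \<open>(h\<^bsup>1/2\<^esup> + i e) (h\<^bsup>1/2\<^esup> - i e)\<^sup>-\<^sup>1\<close>.\<close>

lemma left_unit_approx:
  fixes b :: "'a::{cstar_algebra,monoid_mult}"
  assumes "0 < e"
  obtains w where "norm (b - w * (b * star b) * b) < e"
proof -
  define h where "h = b * star b"
  have "nonneg h" using nonneg_star_mult[of "star b"] by (simp add: h_def star_star)
  then obtain t where t: "star h = h" "0 < t" "norm (t *\<^sub>R 1 - h) \<le> t"
    by (auto simp: nonneg_def)
  from \<open>nonneg h\<close> obtain k where k: "star k = k" "k * k = h" by (rule nonneg_sqrt)
  have kh: "k * h = h * k" by (simp add: mult.assoc flip: k(2))
  define x where "x = (1 / (t + e\<^sup>2)) *\<^sub>R (t *\<^sub>R 1 - h)"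
  have te: "t + e\<^sup>2 > 0" using t by (simp add: add_pos_nonneg)
  have "norm x \<le> t / (t + e\<^sup>2)" using t(3) te by (simp add: x_def divide_right_mono)
  also have "\<dots> < 1" using assms te by simp
  finally obtain w' where w': "w' * (1 - x) = 1" "(1 - x) * w' = 1"
    by (rule one_minus_invertible)
  define w where "w = (1 / (t + e\<^sup>2)) *\<^sub>R w'"
  have "(t + e\<^sup>2) *\<^sub>R x = t *\<^sub>R 1 - h" using te by (simp add: x_def)
  then have "(t + e\<^sup>2) *\<^sub>R (1 - x) = h + e\<^sup>2 *\<^sub>R 1"
    by (simp add: algebra_simps)
  then have "1 - x = (1 / (t + e\<^sup>2)) *\<^sub>R (h + e\<^sup>2 *\<^sub>R 1)"
    using te by (simp flip: \<open>(t + e\<^sup>2) *\<^sub>R (1 - x) = h + e\<^sup>2 *\<^sub>R 1\<close> del: scaleR_diff_right)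
  with w' have w: "w * (h + e\<^sup>2 *\<^sub>R 1) = 1" "(h + e\<^sup>2 *\<^sub>R 1) * w = 1"
    by (simp_all add: w_def del: scaleR_add_right)
  have unique: "v = w" if "v * (h + e\<^sup>2 *\<^sub>R 1) = 1" for v
    by (metis w(2) that mult.assoc mult_1_left mult_1_right)
  have "star ((h + e\<^sup>2 *\<^sub>R 1) * w) = 1" unfolding w(2) by simp
  then have sw: "star w = w" by (intro unique) (simp add: star_simps t)
  have kw: "k * w = w * k"
  proof -
    have "k * (h + e\<^sup>2 *\<^sub>R 1) = (h + e\<^sup>2 *\<^sub>R 1) * k" by (simp add: algebra_simps kh)
    then have "w * (k * (h + e\<^sup>2 *\<^sub>R 1)) * w = w * ((h + e\<^sup>2 *\<^sub>R 1) * k) * w" by simp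
    then show ?thesis by (metis w mult.assoc mult_1_left mult_1_right)
  qed
  then have hw: "h * w = w * h" by (metis k(2) mult.assoc)
  define p q where "p = h * w" and "q = e\<^sup>2 *\<^sub>R w"
  have pq: "p + q = 1" "p * q = q * p"
    using w(2) by (simp_all add: p_def q_def algebra_simps hw)
  define l where "l = (2 * e) *\<^sub>R (k * w)"
  have sl: "star l = l" by (simp add: l_def star_simps k sw kw)
  have sg: "star (p - q) = p - q" by (simp add: p_def q_def star_simps t sw hw)
  have ll: "l * l = 4 *\<^sub>R (p * q)"
  proof -
    have "k * w * (k * w) = h * w * w" by (metis k(2) kw mult.assoc)
    then show ?thesis by (simp add: l_def p_def q_def power2_eq_square)
  qed
  have "(p - q) * l = l * (p - q)"
  proof -
    have "k * p = p * k" "w * p = p * w" by (metis p_def kh kw hw mult.assoc)+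
    then have "k * w * p = p * (k * w)" by (metis mult.assoc)
    moreover have "k * w * q = q * (k * w)" by (simp add: q_def kw mult.assoc)
    ultimately show ?thesis by (simp add: l_def left_diff_distrib right_diff_distrib scaleR_diff_right)
  qed
  then have "star (p - q + \<i> *\<^sub>C l) * (p - q + \<i> *\<^sub>C l) = (p - q) * (p - q) + 4 *\<^sub>R (p * q)"
    using star_mult_cartesian[OF sg sl] ll by simp
  also have "\<dots> = (p + q) * (p + q)"
    using scaleR_add_left[of 2 2 "p * q"] pq(2) by (simp add: algebra_simps scaleR_2)
  also have "\<dots> = 1" using pq(1) by simp
  finally have "(norm (p - q + \<i> *\<^sub>C l))\<^sup>2 \<le> 1"
    by (metis cstar_identity norm_unit_le_1)
  then have "norm l \<le> 1"
    using norm_cartesian_le[OF sg sl] by (simp add: power_le_one_iff abs_square_le_1)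
  then have bound: "2 * e * norm (k * w) \<le> 1" using assms by (simp add: l_def)
  have "norm (w * b) = norm (k * w)"
  proof -
    have "(norm (w * b))\<^sup>2 = norm (w * h * w)"
      by (simp add: h_def star_simps sw mult.assoc flip: norm_mult_star)
    also have "w * h * w = star (k * w) * (k * w)"
      by (simp add: star_simps k sw mult.assoc flip: k(2))
    finally show ?thesis by (simp add: cstar_identity)
  qed
  moreover have "b - w * h * b = e\<^sup>2 *\<^sub>R (w * b)"
  proof -
    have "b = w * (h + e\<^sup>2 *\<^sub>R 1) * b" using w(1) by simp
    also have "\<dots> = w * h * b + e\<^sup>2 *\<^sub>R (w * b)" by (simp add: algebra_simps)
    finally show ?thesis by (simp add: diff_eq_eq add.commute)
  qed
  ultimately have "norm (b - w * h * b) = e / 2 * (2 * e * norm (k * w))"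
    by (simp add: power2_eq_square)
  also have "\<dots> \<le> e / 2 * 1" using bound assms by (intro mult_left_mono) auto
  also have "\<dots> < e" using assms by simp
  finally show thesis using that by (simp add: h_def)
qed

section \<open>The multiplier algebra is a unital $C^*$-algebra\<close>

lemma bounded_linear_scaleC: "bounded_linear (\<lambda>a::'a::complex_normed_vector. c *\<^sub>C a)"
  by (intro bounded_linear_intro[where K = "cmod c"])
    (auto simp: scaleC_add_right scaleR_scaleC scaleC_scaleC norm_scaleC mult.commute)

lemma mult_nondegenerate:
  fixes a :: "'a::cstar_algebra"
  assumes "\<And>b. a * b = 0"
  shows "a = 0"
  using assms[of "star a"] norm_mult_star[of a] by simp

lemma double_centralizer_multiplier: "double_centralizer (lmul m) (rmul m)"
  by transfer auto

lemma lmul_bounded_linear: "bounded_linear (lmul m)"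
  and rmul_bounded_linear: "bounded_linear (rmul m)"
  and lmul_mult: "lmul m (a * b) = lmul m a * b"
  and rmul_mult: "rmul m (a * b) = a * rmul m b"
  and rmul_mult_lmul: "rmul m a * b = a * lmul m b"
  and lmul_add: "lmul m (a + b) = lmul m a + lmul m b"
  and lmul_scaleC: "lmul m (c *\<^sub>C a) = c *\<^sub>C lmul m a"
  using double_centralizer_multiplier[of m]
  by (auto simp: double_centralizer_def clinear_iff)

lemmas lmul_zero = linear_0[OF bounded_linear.linear[OF lmul_bounded_linear]]
lemmas lmul_diff = linear_diff[OF bounded_linear.linear[OF lmul_bounded_linear]]
lemmas lmul_scaleR = linear_scale[OF bounded_linear.linear[OF lmul_bounded_linear]]

text \<open>The algebra is nondegenerate, so each component of a double centralizer determines the other.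
  Multipliers can therefore be handled through their left multiplication alone.\<close>

lemma multiplier_eqI:
  assumes "\<And>a. lmul m a = lmul n a"
  shows "m = n"
proof -
  have "rmul m a - rmul n a = 0" for a
    by (rule mult_nondegenerate) (simp add: left_diff_distrib rmul_mult_lmul assms)
  then have "rmul m = rmul n" by (intro ext) simp
  moreover have "lmul m = lmul n" using assms by (intro ext)
  ultimately show ?thesis
    by transfer (auto simp: prod_eq_iff)
qed

lemma lmul_one [simp]: "lmul 1 a = a"
  by transfer simp

lemma lmul_times [simp]: "lmul (m * n) a = lmul m (lmul n a)"
  by transfer (auto split: prod.splits)

lemma lmul_star: "lmul (star m) a = star (rmul m (star a))"
  and rmul_star: "rmul (star m) a = star (lmul m (star a))"
  by (transfer; auto split: prod.splits)+

instantiation multiplier :: (cstar_algebra) complex_vector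
begin

lift_definition zero_multiplier :: "'a multiplier" is "(\<lambda>a. 0, \<lambda>a. 0)"
  by (simp add: double_centralizer_def clinear_iff)

lift_definition plus_multiplier :: "'a multiplier \<Rightarrow> 'a multiplier \<Rightarrow> 'a multiplier"
  is "\<lambda>(L, R) (L', R'). (\<lambda>a. L a + L' a, \<lambda>a. R a + R' a)"
  by (auto simp: double_centralizer_def clinear_iff bounded_linear_add scaleC_add_right algebra_simps)

lift_definition scaleC_multiplier :: "complex \<Rightarrow> 'a multiplier \<Rightarrow> 'a multiplier"
  is "\<lambda>c (L, R). (\<lambda>a. c *\<^sub>C L a, \<lambda>a. c *\<^sub>C R a)"
  by (auto simp: double_centralizer_def clinear_iff scaleC_add_right scaleC_scaleC mult.commute
      mult_scaleC_left mult_scaleC_right bounded_linear_compose[OF bounded_linear_scaleC])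

definition "scaleR_multiplier r m = complex_of_real r *\<^sub>C (m :: 'a multiplier)"
definition "uminus_multiplier m = (- 1) *\<^sub>C (m :: 'a multiplier)"
definition "minus_multiplier m n = m + (- 1) *\<^sub>C (n :: 'a multiplier)"

lemma lmul_zero_left [simp]: "lmul 0 a = 0"
  by transfer simp

lemma lmul_add_left [simp]: "lmul (m + n) a = lmul m a + lmul n a"
  by transfer (auto split: prod.splits)

lemma lmul_scaleC_left [simp]: "lmul (c *\<^sub>C m) a = c *\<^sub>C lmul m a"
  by transfer (auto split: prod.splits)

instance
  by standard
    (auto intro!: multiplier_eqI simp: scaleR_multiplier_def uminus_multiplier_def
      minus_multiplier_def scaleC_add_right scaleC_add_left scaleC_scaleC scaleC_one add_ac)

end

lemma lmul_scaleR_left [simp]: "lmul (r *\<^sub>R m) a = r *\<^sub>R lmul m a"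
  by (simp add: scaleR_scaleC)

lemma lmul_minus_left [simp]: "lmul (- m) a = - lmul m a"
  using lmul_add_left[of m "- m" a] by (simp add: eq_neg_iff_add_eq_0 add.commute)

lemma lmul_diff_left [simp]: "lmul (m - n) a = lmul m a - lmul n a"
  using lmul_add_left[of m "- n" a] by simp

instantiation multiplier :: (cstar_algebra) "{complex_normed_vector, real_normed_algebra}"
begin

definition norm_multiplier :: "'a multiplier \<Rightarrow> real"
  where "norm m = onorm (lmul m)"

definition dist_multiplier :: "'a multiplier \<Rightarrow> 'a multiplier \<Rightarrow> real"
  where "dist_multiplier m n = norm (m - n)"

definition sgn_multiplier :: "'a multiplier \<Rightarrow> 'a multiplier"
  where "sgn_multiplier m = inverse (norm m) *\<^sub>R m"

definition uniformity_multiplier :: "('a multiplier \<times> 'a multiplier) filter"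
  where "uniformity_multiplier = (INF e\<in>{0 <..}. principal {(x, y). dist x y < e})"

definition open_multiplier :: "'a multiplier set \<Rightarrow> bool"
  where "open_multiplier U = (\<forall>x\<in>U. \<forall>\<^sub>F (x', y) in uniformity. x' = x \<longrightarrow> y \<in> U)"

lemma norm_lmul_le: "norm (lmul m a) \<le> norm m * norm a"
  unfolding norm_multiplier_def by (rule onorm[OF lmul_bounded_linear])

lemma norm_multiplier_nonneg: "0 \<le> norm (m :: 'a multiplier)"
  unfolding norm_multiplier_def by (rule onorm_pos_le[OF lmul_bounded_linear])

lemma norm_multiplier_zero: "norm (0 :: 'a multiplier) = 0"
proof -
  have "lmul (0 :: 'a multiplier) = (\<lambda>a. 0)" by (intro ext) simp
  then show ?thesis by (simp add: norm_multiplier_def onorm_zero)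
qed

lemma norm_multiplier_le: "0 \<le> C \<Longrightarrow> (\<And>a. norm (lmul m a) \<le> C * norm a) \<Longrightarrow> norm m \<le> C"
  unfolding norm_multiplier_def by (rule onorm_bound)

lemma norm_multiplier_scaleC: "norm (c *\<^sub>C m) = cmod c * norm (m :: 'a multiplier)"
proof -
  have le: "norm (c *\<^sub>C m) \<le> cmod c * norm m" for c and m :: "'a multiplier"
    by (rule norm_multiplier_le)
      (simp_all add: norm_scaleC mult.assoc mult_left_mono norm_lmul_le norm_multiplier_nonneg)
  show ?thesis
  proof (cases "c = 0")
    case True
    then show ?thesis by (simp add: norm_multiplier_zero)
  next
    case False
    have "cmod c * norm (inverse c *\<^sub>C (c *\<^sub>C m)) \<le> cmod c * (cmod (inverse c) * norm (c *\<^sub>C m))"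
      by (intro mult_left_mono le) simp
    with False have "cmod c * norm m \<le> norm (c *\<^sub>C m)"
      by (simp add: scaleC_scaleC scaleC_one norm_inverse mult.assoc[symmetric])
    with le[of c m] show ?thesis by simp
  qed
qed

instance
proof
  fix m n k :: "'a multiplier" and r :: real and c :: complex
  show "dist m n = norm (m - n)" by (rule dist_multiplier_def)
  show "sgn m = inverse (norm m) *\<^sub>R m" by (rule sgn_multiplier_def)
  show "(uniformity :: ('a multiplier \<times> 'a multiplier) filter)
      = (INF e\<in>{0 <..}. principal {(x, y). dist x y < e})" by (rule uniformity_multiplier_def)
  show "open U \<longleftrightarrow> (\<forall>x\<in>U. \<forall>\<^sub>F (x', y) in uniformity. x' = x \<longrightarrow> y \<in> U)"
    for U :: "'a multiplier set" by (rule open_multiplier_def)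
  show "norm (c *\<^sub>C m) = cmod c * norm m" by (rule norm_multiplier_scaleC)
  show "norm (r *\<^sub>R m) = \<bar>r\<bar> * norm m" by (simp add: scaleR_scaleC norm_multiplier_scaleC)
  show "norm m = 0 \<longleftrightarrow> m = 0"
  proof
    assume "norm m = 0"
    then show "m = 0" using norm_lmul_le[of m] by (intro multiplier_eqI) simp
  next
    assume "m = 0"
    then show "norm m = 0" by (simp add: norm_multiplier_zero)
  qed
  show "norm (m + n) \<le> norm m + norm n"
  proof (rule norm_multiplier_le)
    show "0 \<le> norm m + norm n" by (simp add: norm_multiplier_nonneg)
    fix a
    have "norm (lmul m a + lmul n a) \<le> norm m * norm a + norm n * norm a"
      by (intro order_trans[OF norm_triangle_ineq] add_mono norm_lmul_le)
    then show "norm (lmul (m + n) a) \<le> (norm m + norm n) * norm a" by (simp add: distrib_right)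
  qed
  show "norm (m * n) \<le> norm m * norm n"
  proof (rule norm_multiplier_le)
    show "0 \<le> norm m * norm n" by (simp add: norm_multiplier_nonneg)
    fix a
    have "norm (lmul m (lmul n a)) \<le> norm m * (norm n * norm a)"
      using norm_lmul_le[of m "lmul n a"] norm_lmul_le[of n a] norm_multiplier_nonneg[of m]
      by (metis mult_left_mono order_trans)
    then show "norm (lmul (m * n) a) \<le> norm m * norm n * norm a" by (simp add: mult.assoc)
  qed
qed (auto intro!: multiplier_eqI simp: lmul_add lmul_scaleR)

end

lemma norm_rmul_le: "norm (rmul m a) \<le> norm m * norm a"
proof (cases "rmul m a = 0")
  case False
  have "norm (rmul m a) * norm (rmul m a) = norm (rmul m a * star (rmul m a))"
    by (simp add: norm_mult_star power2_eq_square)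
  also have "\<dots> = norm (a * lmul m (star (rmul m a)))" by (simp add: rmul_mult_lmul)
  also have "\<dots> \<le> norm a * (norm m * norm (rmul m a))"
    using norm_lmul_le[of m "star (rmul m a)"]
    by (intro order_trans[OF norm_mult_ineq] mult_left_mono) auto
  finally show ?thesis using False by (simp add: mult_ac)
qed simp

lemma rmul_diff_left: "rmul (m - n) a = rmul m a - rmul n a"
proof -
  have "rmul (m - n) a - (rmul m a - rmul n a) = 0"
    by (rule mult_nondegenerate) (simp add: left_diff_distrib rmul_mult_lmul right_diff_distrib)
  then show ?thesis by simp
qed

text \<open>A Cauchy sequence of multipliers gives Cauchy sequences of left and of right multiplications,
  because the operator norm of the right multiplication is bounded by that of the left one; the two
  limits again form a double centralizer.\<close>

instance multiplier :: (cstar_algebra) banach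
proof
  fix X :: "nat \<Rightarrow> 'a multiplier"
  assume X: "Cauchy X"
  have bl: "bounded_linear (lmul m)" "bounded_linear (rmul m)" for m :: "'a multiplier"
    by (rule lmul_bounded_linear rmul_bounded_linear)+
  define l r where "l n = Blinfun (lmul (X n))" and "r n = Blinfun (rmul (X n))" for n
  have lr: "blinfun_apply (l n) a = lmul (X n) a" "blinfun_apply (r n) a = rmul (X n) a" for n a
    by (simp_all add: l_def r_def bounded_linear_Blinfun_apply bl)
  have "dist (l m) (l n) \<le> dist (X m) (X n)" "dist (r m) (r n) \<le> dist (X m) (X n)" for m n
    unfolding dist_norm
    by (auto intro!: norm_blinfun_bound
        simp: blinfun.diff_left lr norm_lmul_le norm_rmul_le simp flip: lmul_diff_left rmul_diff_left)
  then have "Cauchy l" "Cauchy r"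
    using X unfolding Cauchy_def by (meson order_le_less_trans)+
  then obtain L R where LR: "l \<longlonglongrightarrow> L" "r \<longlonglongrightarrow> R"
    by (auto simp: Cauchy_convergent_iff convergent_def)
  have Lim: "(\<lambda>n. lmul (X n) a) \<longlonglongrightarrow> blinfun_apply L a" "(\<lambda>n. rmul (X n) a) \<longlonglongrightarrow> blinfun_apply R a" for a
    using blinfun.tendsto[OF LR(1) tendsto_const, of a] blinfun.tendsto[OF LR(2) tendsto_const, of a]
    by (simp_all add: lr)
  have LC: "blinfun_apply L (c *\<^sub>C a) = c *\<^sub>C blinfun_apply L a" for c a
    using Lim(1)[of "c *\<^sub>C a"] bounded_linear.tendsto[OF bounded_linear_scaleC Lim(1)[of a], of c]
    by (simp add: lmul_scaleC LIMSEQ_unique)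
  have rC: "rmul m (c *\<^sub>C a) = c *\<^sub>C rmul m a" for m :: "'a multiplier" and c a
    using double_centralizer_multiplier[of m] by (simp add: double_centralizer_def clinear_iff)
  have RC: "blinfun_apply R (c *\<^sub>C a) = c *\<^sub>C blinfun_apply R a" for c a
    using Lim(2)[of "c *\<^sub>C a"] bounded_linear.tendsto[OF bounded_linear_scaleC Lim(2)[of a], of c]
    by (simp add: rC LIMSEQ_unique)
  have Lm: "blinfun_apply L (a * b) = blinfun_apply L a * b" for a b
    using Lim(1)[of "a * b"] tendsto_mult[OF Lim(1)[of a] tendsto_const[of b]]
    by (simp add: lmul_mult LIMSEQ_unique)
  have Rm: "blinfun_apply R (a * b) = a * blinfun_apply R b" for a b
    using Lim(2)[of "a * b"] tendsto_mult[OF tendsto_const[of a] Lim(2)[of b]]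
    by (simp add: rmul_mult LIMSEQ_unique)
  have RL: "blinfun_apply R a * b = a * blinfun_apply L b" for a b
    using tendsto_mult[OF Lim(2)[of a] tendsto_const[of b]] tendsto_mult[OF tendsto_const[of a] Lim(1)[of b]]
    by (simp add: rmul_mult_lmul LIMSEQ_unique)
  have dc: "double_centralizer (blinfun_apply L) (blinfun_apply R)"
    by (simp add: double_centralizer_def clinear_iff blinfun.bounded_linear_right blinfun.add_right
        LC RC Lm Rm RL)
  define m where "m = Abs_multiplier (blinfun_apply L, blinfun_apply R)"
  have m: "lmul m a = blinfun_apply L a" for a
    using dc by (simp add: m_def lmul.rep_eq Abs_multiplier_inverse)
  have "norm (X n - m) \<le> norm (l n - L)" for n
    by (rule norm_multiplier_le) (simp_all add: m lr[symmetric] norm_blinfun flip: blinfun.diff_left)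
  moreover have "(\<lambda>n. norm (l n - L)) \<longlonglongrightarrow> 0"
    using LR(1) tendsto_norm_zero LIM_zero by blast
  ultimately have "(\<lambda>n. X n - m) \<longlonglongrightarrow> 0"
    by (intro Lim_null_comparison[of "\<lambda>n. X n - m"]) auto
  then show "convergent X" using LIM_zero_cancel convergentI by blast
qed

text \<open>For \<open>a = b\<close> this bounds \<open>norm (m a)\<close> by means of \<open>norm (m\<^sup>* m)\<close>, which yields the \<open>C\<^sup>*\<close>-identity for
  multipliers.\<close>

lemma star_lmul_mult_lmul: "star (lmul m a) * lmul m b = star a * lmul (star m * m) b"
  by (simp add: rmul_star star_star flip: rmul_mult_lmul)

instance multiplier :: (cstar_algebra) cstar_algebra
proof
  fix m n :: "'a multiplier" and c :: complex
  show "(c *\<^sub>C m) * n = c *\<^sub>C (m * n)" "m * (c *\<^sub>C n) = c *\<^sub>C (m * n)"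
    by (auto intro!: multiplier_eqI simp: lmul_scaleC)
  have "rmul (m + n) = (\<lambda>a. rmul m a + rmul n a)" "rmul (c *\<^sub>C m) = (\<lambda>a. c *\<^sub>C rmul m a)"
    "rmul (m * n) = (\<lambda>a. rmul n (rmul m a))"
    by (transfer; auto split: prod.splits)+
  then show "star (m + n) = star m + star n" "star (c *\<^sub>C m) = cnj c *\<^sub>C star m"
    "star (m * n) = star n * star m" "star (star m) = m"
    by (auto intro!: multiplier_eqI simp: lmul_star rmul_star star_simps)
  \<comment> \<open>This inequality suffices: it forces \<open>norm k \<le> norm (star k)\<close> and hence the converse.\<close>
  have le: "norm k * norm k \<le> norm (star k * k)" for k :: "'a multiplier"
  proof -
    have "norm (lmul k a) \<le> sqrt (norm (star k * k)) * norm a" for a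
    proof -
      have "(norm (lmul k a))\<^sup>2 = norm (star a * lmul (star k * k) a)"
        by (simp only: cstar_identity flip: star_lmul_mult_lmul)
      also have "\<dots> \<le> norm a * (norm (star k * k) * norm a)"
        by (rule order_trans[OF norm_mult_ineq]) (simp add: mult_left_mono norm_lmul_le del: lmul_times)
      also have "\<dots> = (sqrt (norm (star k * k)) * norm a)\<^sup>2"
        by (simp add: power_mult_distrib power2_eq_square)
      finally show ?thesis by (rule power2_le_imp_le) simp
    qed
    then have "norm k \<le> sqrt (norm (star k * k))" by (intro norm_multiplier_le) simp
    then have "(norm k)\<^sup>2 \<le> (sqrt (norm (star k * k)))\<^sup>2" by (intro power_mono) auto
    then show ?thesis by (simp add: power2_eq_square)
  qed
  have le_star: "norm k \<le> norm (star k)" for k :: "'a multiplier"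
  proof (cases "k = 0")
    case False
    then show ?thesis using order_trans[OF le norm_mult_ineq, of k] by simp
  qed simp
  have "norm (star m) \<le> norm m" using le_star[of "star m"] \<open>star (star m) = m\<close> by simp
  then have "norm (star m * m) \<le> norm m * norm m"
    by (intro order_trans[OF norm_mult_ineq] mult_right_mono) auto
  with le[of m] show "norm (star m * m) = (norm m)\<^sup>2" by (simp add: power2_eq_square)
qed

text \<open>The algebra sits isometrically in its multiplier algebra, as an ideal.\<close>

lift_definition inner_multiplier :: "'a::cstar_algebra \<Rightarrow> 'a multiplier"
  is "\<lambda>a. (\<lambda>b. a * b, \<lambda>b. b * a)"
  by (simp add: double_centralizer_def clinear_iff bounded_linear_mult_left bounded_linear_mult_right
      algebra_simps mult_scaleC_left mult_scaleC_right)

lemma lmul_inner [simp]: "lmul (inner_multiplier a) b = a * b"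
  by transfer simp

lemma inner_multiplier_simps:
  "inner_multiplier (a + b) = inner_multiplier a + inner_multiplier b"
  "inner_multiplier (a - b) = inner_multiplier a - inner_multiplier b"
  "inner_multiplier (a * b) = inner_multiplier a * inner_multiplier b"
  "inner_multiplier (star a) = star (inner_multiplier a)"
  "inner_multiplier 0 = 0"
  "inner_multiplier (lmul m a) = m * inner_multiplier a"
proof -
  have "rmul (inner_multiplier a) b = b * a" for b by transfer simp
  then show "inner_multiplier (star a) = star (inner_multiplier a)"
    by (intro multiplier_eqI) (simp add: lmul_star star_simps)
qed (auto intro!: multiplier_eqI simp: algebra_simps lmul_mult)

lemma norm_inner_multiplier: "norm (inner_multiplier a) = norm a"
proof (rule antisym)
  show "norm (inner_multiplier a) \<le> norm a"
    by (rule norm_multiplier_le) (simp_all add: norm_mult_ineq)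
  have "norm a * norm a \<le> norm (inner_multiplier a) * norm a"
    using norm_lmul_le[of "inner_multiplier a" "star a"] norm_mult_star[of a]
    by (simp add: power2_eq_square)
  then show "norm a \<le> norm (inner_multiplier a)"
    by (cases "a = 0") auto
qed

lemma star_mult_sum_eq_0:
  fixes x y :: "'a::cstar_algebra"
  assumes "star x * x + star y * y = 0"
  shows "x = 0"
proof -
  have "star (inner_multiplier x) * inner_multiplier x + star (inner_multiplier y) * inner_multiplier y = 0"
    using arg_cong[OF assms, of inner_multiplier] by (simp only: inner_multiplier_simps)
  then have "inner_multiplier x = 0" by (rule star_mult_add_eq_0)
  then show ?thesis using norm_inner_multiplier[of x] by simp
qed

text \<open>The approximate left unit \<open>w b b\<^sup>*\<close> found in the multiplier algebra lies in the algebra itself.\<close>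

lemma local_left_unit:
  fixes b :: "'a::cstar_algebra"
  assumes "0 < e"
  obtains u where "norm (b - u * b) < e"
proof -
  obtain w where w: "norm (inner_multiplier b - w * (inner_multiplier b * star (inner_multiplier b))
      * inner_multiplier b) < e"
    using left_unit_approx[OF assms] by blast
  have "norm (inner_multiplier (b - lmul w (b * star b) * b)) < e"
    using w by (simp only: inner_multiplier_simps mult.assoc)
  then show thesis using that by (simp only: norm_inner_multiplier)
qed

lemma center_commutes: "z \<in> center \<Longrightarrow> z * m = m * z"
  by (simp add: center_def)

text \<open>A central multiplier commutes in particular with the multiplications by elements of the algebra.\<close>

lemma lmul_eq_rmul_center:
  fixes z :: "'a::cstar_algebra multiplier"
  assumes "z \<in> center"
  shows "lmul z a = rmul z a"
proof -
  have "lmul (z * inner_multiplier a) b = lmul (inner_multiplier a * z) b" for b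
    using center_commutes[OF assms, of "inner_multiplier a"] by simp
  then have "lmul z a * b - rmul z a * b = 0" for b
    by (simp add: lmul_mult rmul_mult_lmul)
  then have "(lmul z a - rmul z a) * b = 0" for b by (simp add: left_diff_distrib)
  then have "lmul z a - rmul z a = 0" by (rule mult_nondegenerate)
  then show ?thesis by simp
qed

lemma mult_center:
  fixes z w :: "'a::semigroup_mult"
  assumes "z \<in> center" "w \<in> center"
  shows "z * w \<in> center"
proof -
  have "z * w * m = m * (z * w)" for m
    using center_commutes[OF assms(1), of m] center_commutes[OF assms(2), of m]
    by (metis mult.assoc)
  then show ?thesis by (simp add: center_def)
qed

lemma inverse_center:
  fixes z :: "'a::monoid_mult"
  assumes "z \<in> center" "z * w = 1" "w * z = 1"
  shows "w \<in> center"
proof -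
  have "w * m = m * w" for m
  proof -
    have "w * (z * m) * w = w * (m * z) * w" using center_commutes[OF assms(1)] by metis
    then show ?thesis using assms(2,3) by (metis mult.assoc mult_1_left mult_1_right)
  qed
  then show ?thesis by (simp add: center_def)
qed

section \<open>Bounded operators on Banach spaces\<close>

text \<open>The solution of \<open>B x = y\<close> is the fixed point of \<open>x \<mapsto> A\<^sup>-\<^sup>1 (y + (A - B) x)\<close>.\<close>

lemma surj_perturbation:
  fixes A B :: "'e::banach \<Rightarrow> 'e"
  assumes A: "linear A" "surj A" and B: "linear B"
    and below: "\<And>x. \<delta> * norm x \<le> norm (A x)"
    and close: "\<And>x. norm (A x - B x) \<le> k * norm x"
    and k: "0 \<le> k" "k < \<delta>"
  shows "surj B"
proof -
  have d: "\<delta> > 0" using k by simp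
  have "\<exists>x. B x = y" for y
  proof -
    define F where "F x = inv A (y + (A x - B x))" for x
    have AF: "A (F x) = y + (A x - B x)" for x
      by (simp add: F_def surj_f_inv_f[OF A(2)])
    have "dist (F x) (F x') \<le> k / \<delta> * dist x x'" for x x'
    proof -
      have "\<delta> * norm (F x - F x') \<le> norm (A (F x) - A (F x'))"
        using below[of "F x - F x'"] by (simp add: linear_diff[OF A(1)])
      also have "A (F x) - A (F x') = A (x - x') - B (x - x')"
        by (simp add: AF linear_diff[OF A(1)] linear_diff[OF B])
      also have "norm \<dots> \<le> k * norm (x - x')" by (rule close)
      finally show ?thesis using d by (simp add: dist_norm field_simps)
    qed
    then have "\<exists>!x. F x = x" using k d by (intro banach_fix_type[of "k / \<delta>"]) auto
    then obtain x where "F x = x" by blast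
    with AF[of x] have "B x = y" by simp
    then show ?thesis ..
  qed
  then show ?thesis by (metis surjI)
qed

text \<open>By Baire's theorem the closure of the image of some ball has an interior point; differences and
  scaling move it to the origin.\<close>

lemma approximate_preimage:
  fixes f :: "'e::real_normed_vector \<Rightarrow> 'f::banach"
  assumes f: "linear f" "surj f"
  obtains M where "0 \<le> M" "\<And>z. \<exists>x. norm x \<le> M * norm z \<and> norm (z - f x) \<le> norm z / 2"
proof -
  define C where "C n = closure (f ` cball 0 (real n))" for n :: nat
  have "\<Union> (range C) = UNIV"
  proof -
    have "y \<in> C (nat \<lceil>norm (inv f y)\<rceil>)" for y
    proof -
      have "inv f y \<in> cball 0 (real (nat \<lceil>norm (inv f y)\<rceil>))" by simp
      then have "f (inv f y) \<in> C (nat \<lceil>norm (inv f y)\<rceil>)"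
        unfolding C_def by (intro subsetD[OF closure_subset] imageI)
      then show ?thesis by (simp add: surj_f_inv_f[OF f(2)])
    qed
    then show ?thesis by blast
  qed
  moreover have "interior (\<Union> (range C)) = {}" if "\<And>n. interior (C n) = {}"
  proof -
    have "euclidean interior_of \<Union> (range C) = {}"
    proof (rule Baire_category_alt)
      show "closedin euclidean S \<and> euclidean interior_of S = {}" if "S \<in> range C" for S
      proof -
        from that obtain n where "S = C n" by blast
        moreover have "closed (C n)" by (simp add: C_def)
        ultimately show ?thesis using \<open>\<And>n. interior (C n) = {}\<close> by simp
      qed
      show "countable (range C)" by simp
      show "completely_metrizable_space (euclidean :: 'f topology) \<or>
          locally_compact_space (euclidean :: 'f topology) \<and> regular_space (euclidean :: 'f topology)"
        using completely_metrizable_space_euclidean by blast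
    qed
    then show ?thesis by simp
  qed
  ultimately obtain n where "interior (C n) \<noteq> {}" by auto
  then obtain y r where r: "0 < r" "ball y r \<subseteq> C n"
    by (meson ex_in_conv mem_interior)
  have near: "\<exists>x. norm x \<le> 2 * real n \<and> norm (z - f x) \<le> e" if z: "norm z < r" and e: "0 < e" for z e
  proof -
    have "y + z \<in> C n" "y \<in> C n" using r z by (auto simp: dist_norm)
    moreover have "\<exists>a. norm a \<le> n \<and> dist (f a) v < e / 2" if "v \<in> C n" for v
    proof -
      from that half_gt_zero[OF e] have "\<exists>p\<in>f ` cball 0 (real n). dist p v < e / 2"
        unfolding C_def closure_approachable by blast
      then show ?thesis by auto
    qed
    ultimately obtain a b where
      "norm a \<le> n" "dist (f a) (y + z) < e / 2" "norm b \<le> n" "dist (f b) y < e / 2"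
      by blast
    moreover have "norm (z - f (a - b)) \<le> norm (f a - (y + z)) + norm (f b - y)"
      using norm_triangle_ineq[of "- (f a - (y + z))" "f b - y"]
      by (simp add: linear_diff[OF f(1)] norm_minus_commute algebra_simps)
    moreover have "norm (a - b) \<le> norm a + norm b" by (rule norm_triangle_ineq4)
    ultimately show ?thesis by (intro exI[of _ "a - b"]) (simp add: dist_norm)
  qed
  show thesis
  proof (rule that[of "2 * real n * (2 / r)"])
    show "0 \<le> 2 * real n * (2 / r)" using r by simp
    show "\<exists>x. norm x \<le> 2 * real n * (2 / r) * norm z \<and> norm (z - f x) \<le> norm z / 2" for z
    proof (cases "z = 0")
      case True
      then show ?thesis by (intro exI[of _ 0]) (simp add: linear_0[OF f(1)])
    next
      case False
      define t where "t = r / (2 * norm z)"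
      have t: "t > 0" "1 / t = 2 / r * norm z" using r False by (simp_all add: t_def)
      have "norm (t *\<^sub>R z) < r" using r False by (simp add: t_def)
      from near[OF this, of "r / 4"] r obtain x where
        x: "norm x \<le> 2 * real n" "norm (t *\<^sub>R z - f x) \<le> r / 4" by auto
      have "z - f ((1 / t) *\<^sub>R x) = (1 / t) *\<^sub>R (t *\<^sub>R z - f x)"
        using t(1) by (simp add: linear_scale[OF f(1)] scaleR_diff_right)
      then have "norm (z - f ((1 / t) *\<^sub>R x)) \<le> (1 / t) * (r / 4)"
        using mult_left_mono[OF x(2), of "1 / t"] t(1) by simp
      also have "\<dots> = norm z / 2" using r by (simp add: t(2))
      finally have "norm (z - f ((1 / t) *\<^sub>R x)) \<le> norm z / 2" .
      moreover have "norm ((1 / t) *\<^sub>R x) \<le> (1 / t) * (2 * real n)"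
        using mult_left_mono[OF x(1), of "1 / t"] t(1) by simp
      ultimately show ?thesis
        by (intro exI[of _ "(1 / t) *\<^sub>R x"]) (simp add: t(2) mult_ac)
    qed
  qed
qed

text \<open>Banach's inverse mapping theorem. Correcting the error of the approximate preimage \<open>h z\<close> again and
  again writes \<open>z\<close> as the image of a series that is dominated by a geometric one.\<close>

lemma bounded_linear_inv:
  fixes f :: "'e::banach \<Rightarrow> 'f::banach"
  assumes f: "bounded_linear f" "bij f"
  shows "bounded_linear (inv f)"
proof -
  have lin: "linear f" by (rule bounded_linear.linear[OF f(1)])
  from approximate_preimage[OF lin bij_is_surj[OF f(2)]] obtain M h where M: "0 \<le> M"
    and h: "\<And>z. norm (h z) \<le> M * norm z" "\<And>z. norm (z - f (h z)) \<le> norm z / 2" by metis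
  have bound: "norm (inv f z) \<le> norm z * (2 * M)" for z
  proof -
    define r where "r n = ((\<lambda>z. z - f (h z)) ^^ n) z" for n
    have r: "norm (r n) \<le> (1/2) ^ n * norm z" for n
    proof (induction n)
      case (Suc n)
      then show ?case using h(2)[of "r n"] by (simp add: r_def)
    qed (simp add: r_def)
    have "f (\<Sum>i<n. h (r i)) = z - r n" for n
      by (induction n) (simp_all add: r_def linear_0[OF lin] linear_add[OF lin])
    moreover have r0: "r \<longlonglongrightarrow> 0"
    proof (rule Lim_null_comparison)
      show "(\<lambda>n. (1/2) ^ n * norm z) \<longlonglongrightarrow> 0"
        by (intro tendsto_mult_left_zero LIMSEQ_realpow_zero) auto
    qed (use r in auto)
    moreover have hr: "norm (h (r n)) \<le> M * norm z * (1/2) ^ n" for n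
      using order_trans[OF h(1)[of "r n"] mult_left_mono[OF r[of n] M]] by (simp add: mult_ac)
    moreover have geom: "(\<lambda>n. M * norm z * (1/2) ^ n) sums (M * norm z * 2)"
      using sums_mult[OF geometric_sums[of "1/2::real"], of "M * norm z"] by simp
    ultimately have s: "summable (\<lambda>n. h (r n))"
      by (intro summable_comparison_test'[OF sums_summable[OF geom], of 0]) auto
    have "(\<lambda>n. f (\<Sum>i<n. h (r i))) \<longlonglongrightarrow> f (\<Sum>i. h (r i))"
      by (intro bounded_linear.tendsto[OF f(1)] summable_LIMSEQ s)
    moreover have "(\<lambda>n. f (\<Sum>i<n. h (r i))) \<longlonglongrightarrow> z"
      unfolding \<open>\<And>n. f (\<Sum>i<n. h (r i)) = z - r n\<close> using tendsto_diff[OF tendsto_const r0, of z] by simp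
    ultimately have "f (\<Sum>i. h (r i)) = z" using LIMSEQ_unique by blast
    then have "inv f z = (\<Sum>i. h (r i))" using f(2) by (metis bij_is_inj inv_f_f)
    also have "norm \<dots> \<le> M * norm z * 2"
      using norm_suminf_le[OF hr sums_summable[OF geom]] by (simp only: sums_unique[OF geom, symmetric])
    finally show ?thesis by (simp add: mult_ac)
  qed
  have fi: "f (inv f y) = y" "inv f (f x) = x" for x y
    using f(2) by (simp_all add: bij_is_surj surj_f_inv_f bij_is_inj)
  show ?thesis
  proof (rule bounded_linear_intro[OF _ _ bound])
    show "inv f (x + y) = inv f x + inv f y" for x y
      by (metis fi linear_add[OF lin])
    show "inv f (c *\<^sub>R x) = c *\<^sub>R inv f x" for c x
      by (metis fi linear_scale[OF lin])
  qed
qed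

section \<open>Hilbert modules and the action of multipliers\<close>

lemma clinear_imp_linear: "clinear f \<Longrightarrow> linear f"
  by (auto simp: clinear_iff scaleR_scaleC intro: linearI)

context hilbert_module
begin

lemma ip_add_right: "ip x (y + z) = ip x y + ip x z"
  by (metis star_ip star_add ip_add_left)

lemma ip_scaleC_right: "ip x (c *\<^sub>C y) = cnj c *\<^sub>C ip x y"
  by (metis star_ip star_scaleC ip_scaleC_left)

lemma ip_act_right: "ip x (act a y) = ip x y * star a"
  by (metis star_ip star_mult ip_act_left)

lemma ip_diff_left: "ip (x - y) z = ip x z - ip y z"
  using ip_add_left[of "x - y" y z] by (simp add: algebra_simps)

lemma ip_diff_right: "ip x (y - z) = ip x y - ip x z"
  using ip_add_right[of x "y - z" z] by (simp add: algebra_simps)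

lemma ip_zero_left [simp]: "ip 0 y = 0"
  using ip_diff_left[of 0 0 y] by simp

lemma ip_scaleR_left: "ip (r *\<^sub>R x) y = r *\<^sub>R ip x y"
  by (simp add: scaleR_scaleC ip_scaleC_left)

lemma ip_scaleR_right: "ip x (r *\<^sub>R y) = r *\<^sub>R ip x y"
  by (simp add: scaleR_scaleC ip_scaleC_right)

lemma norm_ip_self: "norm (ip x x) = (norm x)\<^sup>2"
  by (simp add: norm_eq_sqrt_norm_ip)

lemma eq_if_ip_eq:
  assumes "\<And>z. ip x z = ip y z"
  shows "x = y"
proof -
  have "ip (x - y) (x - y) = 0" using assms by (simp add: ip_diff_left)
  then show ?thesis using ip_self_eq_0_iff by simp
qed

lemma eq_if_ip_eq_right:
  assumes "\<And>z. ip z x = ip z y"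
  shows "x = y"
proof (rule eq_if_ip_eq)
  show "ip x z = ip y z" for z using assms[of z] by (metis star_ip)
qed

text \<open>A weak form of the Cauchy-Schwarz inequality. It comes from polarization and the triangle
  inequality, without the order of the algebra, and the constant is immaterial for the continuity and
  boundedness arguments below.\<close>

lemma norm_ip_le: "norm (ip x y) \<le> 4 * norm x * norm y"
proof -
  \<comment> \<open>This is the polarization identity, the sum of \<open>i\<^sup>k \<langle>x + i\<^sup>k y, x + i\<^sup>k y\<rangle>\<close> over \<open>k < 4\<close>.\<close>
  have polar: "4 *\<^sub>C ip x y = ip (x + y) (x + y) - ip (x - y) (x - y)
      + \<i> *\<^sub>C ip (x + \<i> *\<^sub>C y) (x + \<i> *\<^sub>C y) - \<i> *\<^sub>C ip (x - \<i> *\<^sub>C y) (x - \<i> *\<^sub>C y)" for x y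
  proof -
    have "4 *\<^sub>C ip x y = (1 + 1 + 1 + 1) *\<^sub>C ip x y" by simp
    also have "\<dots> = ip x y + ip x y + ip x y + ip x y"
      by (simp only: scaleC_add_left scaleC_one)
    finally show ?thesis
      by (simp add: ip_add_left ip_add_right ip_diff_left ip_diff_right ip_scaleC_left ip_scaleC_right
          scaleC_scaleC scaleC_add_right complex_vector.scale_right_diff_distrib scaleC_one
          complex_vector.scale_minus_left algebra_simps)
  qed
  have unit: "norm (ip u v) \<le> 4" if "norm u \<le> 1" "norm v \<le> 1" for u v
  proof -
    have q: "norm (ip w w) \<le> 4" if "norm w \<le> 2" for w
      using power_mono[OF that norm_ge_zero, of 2] by (simp add: norm_ip_self)
    have n: "norm (u + v) \<le> 2" "norm (u - v) \<le> 2" "norm (u + \<i> *\<^sub>C v) \<le> 2" "norm (u - \<i> *\<^sub>C v) \<le> 2"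
      using that norm_triangle_ineq[of u v] norm_triangle_ineq4[of u v]
        norm_triangle_ineq[of u "\<i> *\<^sub>C v"] norm_triangle_ineq4[of u "\<i> *\<^sub>C v"]
      by (simp_all add: norm_scaleC)
    have "4 * norm (ip u v) = norm (4 *\<^sub>C ip u v)" by (simp add: norm_scaleC)
    also have "\<dots> \<le> ((4 + 4) + 4) + 4"
      unfolding polar
      by (intro order_trans[OF norm_triangle_ineq4] order_trans[OF norm_triangle_ineq] add_mono)
        (use q[OF n(1)] q[OF n(2)] q[OF n(3)] q[OF n(4)] in \<open>simp_all add: norm_scaleC\<close>)
    finally show ?thesis by simp
  qed
  show ?thesis
  proof (cases "x = 0 \<or> y = 0")
    case True
    have "ip x 0 = 0" using ip_diff_right[of x 0 0] by simp
    with True show ?thesis by auto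
  next
    case False
    have "ip x y = (norm x * norm y) *\<^sub>R ip ((1 / norm x) *\<^sub>R x) ((1 / norm y) *\<^sub>R y)"
      using False by (simp add: ip_scaleR_left ip_scaleR_right)
    then have "norm (ip x y) = norm x * norm y * norm (ip ((1 / norm x) *\<^sub>R x) ((1 / norm y) *\<^sub>R y))"
      by (metis abs_of_nonneg mult_nonneg_nonneg norm_ge_zero norm_scaleR)
    also have "\<dots> \<le> norm x * norm y * 4"
      using False by (intro mult_left_mono unit) auto
    finally show ?thesis by (simp add: mult_ac)
  qed
qed

lemma ip_tendsto_left:
  assumes "X \<longlonglongrightarrow> x"
  shows "(\<lambda>n. ip (X n) y) \<longlonglongrightarrow> ip x y"
proof -
  have "bounded_linear (\<lambda>x. ip x y)"
    using norm_ip_le[of _ y]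
    by (intro bounded_linear_intro[where K = "4 * norm y"]) (auto simp: ip_add_left ip_scaleR_left mult_ac)
  then show ?thesis using assms by (rule bounded_linear.tendsto)
qed

text \<open>Norms of multiples of \<open>x\<close> are norms in the algebra, where \<open>d\<close> plays the part of \<open>\<langle>x, x\<rangle>\<^bsup>1/2\<^esup>\<close>; any
  \<open>d\<close> with \<open>\<langle>x, x\<rangle> = d d\<^sup>*\<close> will do. Estimates about the action thus reduce to estimates in the
  algebra.\<close>

lemma norm_act:
  obtains d where "\<And>a. norm (act a x) = norm (a * d)" "\<And>a. norm (x - act a x) = norm (d - a * d)"
    "norm x = norm d"
proof -
  from ip_self_positive[of x] obtain b where b: "ip x x = star b * b" by (auto simp: cpositive_def)
  have *: "norm z = norm c" if "ip z z = c * star c" for z c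
    using that norm_ip_self[of z] norm_mult_star[of c] by simp
  show thesis
  proof (rule that[of "star b"])
    show "norm (act a x) = norm (a * star b)" for a
      by (rule *) (simp add: ip_act_left ip_act_right b star_simps mult.assoc)
    show "norm (x - act a x) = norm (star b - a * star b)" for a
      by (rule *) (simp add: ip_act_left ip_act_right ip_diff_left ip_diff_right b star_simps algebra_simps)
    show "norm x = norm (star b)" by (rule *) (simp add: b star_simps)
  qed
qed

lemma approximate_unit_sequence:
  obtains u where "(\<lambda>n. act (u n) x) \<longlonglongrightarrow> x"
proof -
  from norm_act[of x] obtain d where d: "\<And>a. norm (x - act a x) = norm (d - a * d)" by metis
  have "\<exists>u. norm (d - u * d) < 1 / real (Suc n)" for n
    using local_left_unit[of "1 / real (Suc n)" d] by auto
  then obtain u where u: "\<And>n. norm (d - u n * d) < 1 / real (Suc n)" by metis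
  have "norm (x - act (u n) x) \<le> 1 / real (Suc n)" for n
    using u[of n] by (simp only: d)
  then have "(\<lambda>n. x - act (u n) x) \<longlonglongrightarrow> 0"
    by (intro Lim_null_comparison[OF always_eventually LIMSEQ_Suc[OF lim_1_over_n]]) blast
  then have "(\<lambda>n. x - (x - act (u n) x)) \<longlonglongrightarrow> x - 0" by (intro tendsto_intros)
  then show thesis using that by simp
qed

text \<open>The vector \<open>z = m x\<close> is the limit of \<open>(m u\<^sub>n) x\<close> for any sequence with \<open>u\<^sub>n x\<close> tending to \<open>x\<close>. The
  formula for \<open>\<langle>z, y\<rangle>\<close> determines \<open>z\<close>, so that the limit does not depend on the sequence and is linear
  in \<open>x\<close>.\<close>

lemma multiplier_action_exists:
  "\<exists>z. (\<forall>y. ip z y = lmul m (ip x y)) \<and> norm z \<le> norm m * norm x"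
proof -
  from norm_act[of x] obtain d where d: "\<And>a. norm (act a x) = norm (a * d)"
    "\<And>a. norm (x - act a x) = norm (d - a * d)" "norm x = norm d" by metis
  from approximate_unit_sequence[of x] obtain u where u: "(\<lambda>n. act (u n) x) \<longlonglongrightarrow> x" .
  define z where "z n = act (lmul m (u n)) x" for n
  have act_diff: "act (a - b) x = act a x - act b x" for a b
    using act_add_left[of "a - b" b x] by (simp add: algebra_simps)
  have zu: "norm (z i - z j) \<le> norm m * norm (act (u i) x - act (u j) x)" for i j
  proof -
    have "z i - z j = act (lmul m (u i - u j)) x" by (simp add: z_def act_diff lmul_diff)
    then have "norm (z i - z j) = norm (lmul m ((u i - u j) * d))" by (simp add: d lmul_mult)
    also have "\<dots> \<le> norm m * norm ((u i - u j) * d)" by (rule norm_lmul_le)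
    also have "norm ((u i - u j) * d) = norm (act (u i) x - act (u j) x)"
      by (simp flip: d(1) act_diff)
    finally show ?thesis .
  qed
  have "Cauchy z"
  proof (rule CauchyI)
    fix e :: real assume "0 < e"
    then have "0 < e / (norm m + 1)" by (simp add: add_nonneg_pos)
    with LIMSEQ_imp_Cauchy[OF u] obtain M where
      M: "\<And>i j. i \<ge> M \<Longrightarrow> j \<ge> M \<Longrightarrow> norm (act (u i) x - act (u j) x) < e / (norm m + 1)"
      by (metis CauchyD)
    have "norm (z i - z j) < e" if "i \<ge> M" "j \<ge> M" for i j
    proof -
      have "norm (z i - z j) \<le> (norm m + 1) * norm (act (u i) x - act (u j) x)"
        using zu[of i j] by (simp add: distrib_right add_increasing2)
      also have "\<dots> < (norm m + 1) * (e / (norm m + 1))"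
        by (intro mult_strict_left_mono M that) (simp add: add_nonneg_pos)
      also have "\<dots> = e"
        using norm_ge_zero[of m] by (simp del: norm_ge_zero)
      finally show ?thesis .
    qed
    then show "\<exists>M. \<forall>i\<ge>M. \<forall>j\<ge>M. norm (z i - z j) < e" by blast
  qed
  then obtain w where w: "z \<longlonglongrightarrow> w" by (auto simp: Cauchy_convergent_iff convergent_def)
  have "ip w y = lmul m (ip x y)" for y
  proof -
    have "ip (z n) y = lmul m (ip (act (u n) x) y)" for n
      by (simp add: z_def ip_act_left lmul_mult)
    moreover have "(\<lambda>n. lmul m (ip (act (u n) x) y)) \<longlonglongrightarrow> lmul m (ip x y)"
      by (intro bounded_linear.tendsto[OF lmul_bounded_linear] ip_tendsto_left u)
    ultimately show ?thesis using ip_tendsto_left[OF w, of y] LIMSEQ_unique by simp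
  qed
  moreover have "norm w \<le> norm m * norm x"
  proof (rule LIMSEQ_le)
    show "(\<lambda>n. norm (z n)) \<longlonglongrightarrow> norm w" by (intro tendsto_norm w)
    show "(\<lambda>n. norm m * norm (act (u n) x)) \<longlonglongrightarrow> norm m * norm x"
      by (intro tendsto_mult tendsto_const tendsto_norm u)
    have "norm (z n) \<le> norm m * norm (act (u n) x)" for n
      using norm_lmul_le[of m "u n * d"] by (simp add: z_def d lmul_mult)
    then show "\<exists>N. \<forall>n\<ge>N. norm (z n) \<le> norm m * norm (act (u n) x)" by blast
  qed
  ultimately show ?thesis by blast
qed

text \<open>Since \<open>x\<close> is a limit of multiples \<open>u\<^sub>n x\<close>, a bounded map with \<open>f (a x) = (m a) x\<close> is unique, and
  the vectors just constructed provide one.\<close>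

lemma mult_act_properties:
  "ip (mult_act act m x) y = lmul m (ip x y)" "clinear (mult_act act m)"
  "bounded_linear (mult_act act m)"
proof -
  from multiplier_action_exists[of m] obtain f where
    f: "\<And>x y. ip (f x) y = lmul m (ip x y)" "\<And>x. norm (f x) \<le> norm m * norm x" by metis
  have cl: "clinear f"
    unfolding clinear_iff
    by (auto intro!: eq_if_ip_eq simp: f ip_add_left ip_scaleC_left lmul_add lmul_scaleC)
  have bl: "bounded_linear f"
    using f(2) linear_add[OF clinear_imp_linear[OF cl]] linear_scale[OF clinear_imp_linear[OF cl]]
    by (intro bounded_linear_intro[where K = "norm m"]) (auto simp: mult.commute)
  have fa: "f (act a x) = act (lmul m a) x" for a x
    by (rule eq_if_ip_eq) (simp add: f ip_act_left lmul_mult)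
  have "mult_act act m = f"
    unfolding mult_act_def
  proof (rule the_equality)
    show "clinear f \<and> bounded_linear f \<and> (\<forall>a x. f (act a x) = act (lmul m a) x)"
      using cl bl fa by blast
    fix g assume g: "clinear g \<and> bounded_linear g \<and> (\<forall>a x. g (act a x) = act (lmul m a) x)"
    show "g = f"
    proof
      fix x
      from approximate_unit_sequence[of x] obtain u where u: "(\<lambda>n. act (u n) x) \<longlonglongrightarrow> x" .
      have "(\<lambda>n. g (act (u n) x)) \<longlonglongrightarrow> g x" "(\<lambda>n. f (act (u n) x)) \<longlonglongrightarrow> f x"
        using g bl u bounded_linear.tendsto by blast+
      then show "g x = f x" using g fa LIMSEQ_unique by simp
    qed
  qed
  with f cl bl show "ip (mult_act act m x) y = lmul m (ip x y)" "clinear (mult_act act m)"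
    "bounded_linear (mult_act act m)" by simp_all
qed

lemma mult_act_times: "mult_act act (m * n) x = mult_act act m (mult_act act n x)"
  by (rule eq_if_ip_eq) (simp add: mult_act_properties)

lemma mult_act_one: "mult_act act 1 x = x"
  by (rule eq_if_ip_eq) (simp add: mult_act_properties)

lemma ip_mult_act_right:
  assumes "z \<in> center"
  shows "ip x (mult_act act (star z) y) = lmul z (ip x y)"
proof -
  have "ip x (mult_act act (star z) y) = star (lmul (star z) (ip y x))"
    by (metis mult_act_properties(1) star_ip)
  also have "\<dots> = rmul z (ip x y)" by (simp add: lmul_star star_simps star_ip)
  finally show ?thesis by (simp add: lmul_eq_rmul_center[OF assms])
qed

section \<open>Adjointable operators\<close>

lemma adjoint_commutes_mult_act:
  assumes "is_adjoint ip T T'"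
  shows "T (mult_act act m x) = mult_act act m (T x)"
  using assms
  by (intro eq_if_ip_eq) (simp add: mult_act_properties is_adjoint_def)

lemma is_adjoint_sym: "is_adjoint ip T T' \<Longrightarrow> is_adjoint ip T' T"
  unfolding is_adjoint_def by (metis star_ip)

lemma op_adjoint_eq:
  assumes "is_adjoint ip T T'"
  shows "op_adjoint ip T = T'"
  unfolding op_adjoint_def
proof (rule the_equality[where P = "is_adjoint ip T", OF assms])
  fix R assume "is_adjoint ip T R"
  with assms show "R = T'"
    by (intro ext eq_if_ip_eq_right) (simp add: is_adjoint_def)
qed

lemma is_adjoint_module_linear:
  assumes "is_adjoint ip T T'"
  shows "module_linear act T"
  using assms unfolding module_linear_def clinear_iff
  by (auto intro!: eq_if_ip_eq simp: is_adjoint_def ip_add_left ip_scaleC_left ip_act_left)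

lemma is_adjoint_bounded:
  assumes T: "is_adjoint ip T T'" and "bounded_linear T'"
  shows "bounded_linear T"
proof -
  from assms(2) obtain K where K: "\<And>x. norm (T' x) \<le> norm x * K" "0 \<le> K"
    using bounded_linear.nonneg_bounded by blast
  have lin: "linear T"
    using is_adjoint_module_linear[OF T] by (simp add: module_linear_def clinear_imp_linear)
  have "norm (T x) \<le> norm x * (4 * K)" for x
  proof (cases "T x = 0")
    case False
    have "norm (T x) * norm (T x) = norm (ip x (T' (T x)))"
      using T norm_ip_self[of "T x"] by (simp add: is_adjoint_def power2_eq_square)
    also have "\<dots> \<le> 4 * norm x * (norm (T x) * K)"
      by (rule order_trans[OF norm_ip_le]) (intro mult_left_mono K, simp)
    finally show ?thesis using False by (simp add: mult_ac)
  qed (simp add: K)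
  then show ?thesis
    by (intro bounded_linear_intro[where K = "4 * K"]) (auto simp: linear_add[OF lin] linear_scale[OF lin])
qed

text \<open>The element \<open>r \<langle>x, x\<rangle>\<close> is the imaginary part of \<open>\<langle>Q x + i r x, x\<rangle>\<close>; the factor \<open>1/4\<close> comes from the
  constant in \<open>norm_ip_le\<close>.\<close>

lemma selfadjoint_imaginary_bound:
  assumes Q: "is_adjoint ip Q Q"
  shows "\<bar>r\<bar> / 4 * norm x \<le> norm (Q x + (\<i> * of_real r) *\<^sub>C x)"
proof (cases "x = 0")
  case False
  define y where "y = Q x + (\<i> * of_real r) *\<^sub>C x"
  have "star (ip (Q x) x) = ip (Q x) x" "star (ip x x) = ip x x"
    using Q by (simp_all add: is_adjoint_def star_ip)
  moreover have "ip y x = ip (Q x) x + \<i> *\<^sub>C (r *\<^sub>R ip x x)"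
    by (simp add: y_def ip_add_left ip_scaleC_left scaleR_scaleC scaleC_scaleC)
  ultimately have "norm (r *\<^sub>R ip x x) \<le> norm (ip y x)"
    using norm_cartesian_le[of "ip (Q x) x" "r *\<^sub>R ip x x"] by (simp add: star_scaleR)
  also have "\<dots> \<le> 4 * norm y * norm x" by (rule norm_ip_le)
  finally have "\<bar>r\<bar> * norm x * norm x \<le> 4 * norm y * norm x"
    by (simp add: norm_ip_self power2_eq_square mult_ac)
  with False show ?thesis by (simp add: y_def)
qed simp

text \<open>The self-adjoint operator \<open>Q = W V\<close> is bounded below by \<open>c\<^sup>2 / 4\<close>. For \<open>r\<close> beyond the bound of \<open>Q\<close>,
  the operator \<open>Q + i r\<close> is a small perturbation of \<open>i r\<close> and thus surjective. It is bounded below by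
  \<open>r / 4\<close>, so \<open>r\<close> may be shrunk by the factor \<open>7/8\<close> repeatedly. Once \<open>r < c\<^sup>2 / 8\<close>, it is bounded below by
  \<open>c\<^sup>2 / 8\<close> and \<open>Q\<close> itself is a small perturbation of it.\<close>

lemma bounded_below_imp_adjoint_surj:
  assumes adj: "is_adjoint ip V W" and V: "bounded_linear V" and W: "bounded_linear W"
    and c: "0 < c" "\<And>x. c * norm x \<le> norm (V x)"
  shows "surj W"
proof -
  define Q where "Q x = W (V x)" for x
  have Q: "is_adjoint ip Q Q"
    using adj is_adjoint_sym[OF adj] by (simp add: is_adjoint_def Q_def)
  have bQ: "bounded_linear Q" unfolding Q_def by (rule bounded_linear_compose[OF W V])
  have linQ: "linear Q" by (rule bounded_linear.linear[OF bQ])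
  define Qi where "Qi r x = Q x + (\<i> * of_real r) *\<^sub>C x" for r x
  have lin: "linear (Qi r)" for r
    unfolding Qi_def by (intro linear_compose_add linQ bounded_linear.linear[OF bounded_linear_scaleC])
  have diff: "norm (Qi r x - Qi s x) = \<bar>r - s\<bar> * norm x" for r s x
  proof -
    have "Qi r x - Qi s x = (\<i> * of_real (r - s)) *\<^sub>C x"
      by (simp add: Qi_def complex_vector.scale_left_diff_distrib right_diff_distrib)
    then show ?thesis by (simp add: norm_scaleC norm_mult del: of_real_diff)
  qed
  from bounded_linear.pos_bounded[OF bQ] obtain K where K: "0 < K" "\<And>x. norm (Q x) \<le> norm x * K"
    by blast
  have start: "surj (Qi (K + 1))"
  proof (rule surj_perturbation[where A = "\<lambda>x. (\<i> * of_real (K + 1)) *\<^sub>C x" and \<delta> = "K + 1" and k = K])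
    show "linear (\<lambda>x::'e. (\<i> * of_real (K + 1)) *\<^sub>C x)"
      by (rule bounded_linear.linear[OF bounded_linear_scaleC])
    have "(\<i> * of_real (K + 1)) *\<^sub>C (inverse (\<i> * of_real (K + 1)) *\<^sub>C x) = x" for x :: 'e
    proof -
      have "\<i> * complex_of_real (K + 1) \<noteq> 0"
        using K(1) by (simp only: mult_eq_0_iff of_real_eq_0_iff) auto
      then show ?thesis by (simp only: scaleC_scaleC right_inverse scaleC_one if_True not_False_eq_True)
    qed
    then show "surj (\<lambda>x::'e. (\<i> * of_real (K + 1)) *\<^sub>C x)" by (rule surjI)
    show "(K + 1) * norm x \<le> norm ((\<i> * of_real (K + 1)) *\<^sub>C x)" for x :: 'e
      using K by (simp add: norm_scaleC norm_mult del: of_real_add)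
    show "norm ((\<i> * of_real (K + 1)) *\<^sub>C x - Qi (K + 1) x) \<le> K * norm x" for x :: 'e
      using K(2)[of x] by (simp add: Qi_def mult.commute)
  qed (use K lin in auto)
  have step: "surj (Qi ((7/8) ^ n * (K + 1)))" for n
  proof (induction n)
    case (Suc n)
    define r where "r = (7/8) ^ n * (K + 1)"
    have r: "r > 0" using K by (simp add: r_def)
    have "surj (Qi (7/8 * r))"
    proof (rule surj_perturbation[where A = "Qi r" and \<delta> = "r / 4" and k = "r / 8"])
      show "r / 4 * norm x \<le> norm (Qi r x)" for x
        using selfadjoint_imaginary_bound[OF Q, of r x] r by (simp add: Qi_def)
      show "norm (Qi r x - Qi (7/8 * r) x) \<le> r / 8 * norm x" for x
        using r by (simp add: diff)
    qed (use Suc[folded r_def] r lin in simp_all)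
    then show ?case by (simp add: r_def mult.assoc)
  qed (simp add: start)
  have Qbelow: "c\<^sup>2 / 4 * norm x \<le> norm (Q x)" for x
  proof (cases "x = 0")
    case False
    have "c\<^sup>2 * (norm x)\<^sup>2 \<le> (norm (V x))\<^sup>2"
      using power_mono[OF c(2)[of x], of 2] c(1) by (simp add: power_mult_distrib)
    also have "\<dots> = norm (ip (Q x) x)"
      using is_adjoint_sym[OF adj] by (simp add: Q_def is_adjoint_def norm_ip_self)
    also have "\<dots> \<le> 4 * norm (Q x) * norm x" by (rule norm_ip_le)
    finally show ?thesis using False by (simp add: power2_eq_square mult_ac)
  qed simp
  obtain n where "(7/8) ^ n < c\<^sup>2 / (8 * (K + 1))"
    using real_arch_pow_inv[of "c\<^sup>2 / (8 * (K + 1))" "7/8"] c K by auto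
  then have n: "(7/8) ^ n * (K + 1) < c\<^sup>2 / 8" using K by (simp add: field_simps)
  define r where "r = (7/8) ^ n * (K + 1)"
  have r: "0 < r" "r < c\<^sup>2 / 8" using n K by (simp_all add: r_def)
  have "surj (Qi 0)"
  proof (rule surj_perturbation[where A = "Qi r" and \<delta> = "c\<^sup>2 / 8" and k = r])
    show "c\<^sup>2 / 8 * norm x \<le> norm (Qi r x)" for x
    proof -
      have "norm (Qi 0 x) \<le> norm (Qi r x) + norm (Qi r x - Qi 0 x)"
        using norm_triangle_ineq4[of "Qi r x" "Qi r x - Qi 0 x"] by simp
      then have "norm (Q x) \<le> norm (Qi r x) + r * norm x"
        using r by (simp add: diff) (simp add: Qi_def)
      moreover have "r * norm x \<le> c\<^sup>2 / 8 * norm x" using r by (intro mult_right_mono) auto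
      ultimately show ?thesis using Qbelow[of x] by simp
    qed
    show "norm (Qi r x - Qi 0 x) \<le> r * norm x" for x using r by (simp add: diff)
  qed (use step[of n, folded r_def] r lin in simp_all)
  moreover have "Qi 0 = (\<lambda>x. W (V x))" by (auto simp: Qi_def Q_def)
  ultimately have "surj (\<lambda>x. W (V x))" by simp
  then show ?thesis unfolding surj_def by blast
qed

end

text \<open>A multiplier is continuous, and the inner products span a dense subspace.\<close>

lemma (in full_hilbert_module) multiplier_eq_0_if_ip:
  assumes "\<And>x y. lmul m (ip x y) = 0"
  shows "m = 0"
proof (rule multiplier_eqI)
  fix a
  have "complex_vector.span {ip x y | x y. True} \<subseteq> {b. lmul m b = 0}"
    by (rule complex_vector.span_minimal)
      (auto simp: complex_vector.subspace_def assms lmul_add lmul_scaleC lmul_zero)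
  moreover have "closed {b. lmul m b = 0}"
    by (intro closed_Collect_eq linear_continuous_on lmul_bounded_linear continuous_on_const)
  ultimately have "closure (complex_vector.span {ip x y | x y. True}) \<subseteq> {b. lmul m b = 0}"
    by (rule closure_minimal)
  then show "lmul m a = lmul 0 a" using full by auto
qed

section \<open>Pairs of operators that preserve the inner product up to a multiplier\<close>

context full_hilbert_module
begin

lemma mult_act_bij:
  assumes "m * n = 1" "n * m = 1"
  shows "bij (mult_act act m)"
  by (rule o_bij[of "mult_act act n"])
    (simp_all add: fun_eq_iff assms mult_act_one flip: mult_act_times)

text \<open>On the range of \<open>n\<close>, which is twice the negative part of \<open>z\<close>, the operator \<open>T\<close> would turn
  \<open>\<langle>\<sigma> x, \<sigma> x\<rangle>\<close> into its negative. The elements \<open>n\<close> and \<open>\<sigma>\<close> are central because they commute with all that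
  commutes with \<open>z\<close>.\<close>

lemma gram_multiplier_positive:
  assumes z: "z \<in> center"
    and gram: "\<And>x y. ip (T x) (T y) = lmul z (ip x y)"
  shows "nonneg z"
proof -
  have "lmul (star z - z) (ip x y) = 0" for x y
  proof -
    have "lmul (star z) (ip x y) = star (lmul z (ip y x))"
      by (simp add: lmul_star lmul_eq_rmul_center[OF z] star_ip)
    also have "\<dots> = lmul z (ip x y)" by (simp add: star_ip flip: gram)
    finally show ?thesis by simp
  qed
  then have "star z = z" using multiplier_eq_0_if_ip by fastforce
  then obtain n s where ns: "star n = n" "star s = s" "s * n = n * s"
    "n * z * n = - (s * n * (s * n))" "\<And>y. z * y = y * z \<Longrightarrow> n * y = y * n"
    "\<And>y. z * y = y * z \<Longrightarrow> s * y = y * s" "s * n = 0 \<Longrightarrow> nonneg z"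
    by (rule negative_part) (rule that; blast)
  have nc: "n \<in> center" and sc: "s \<in> center"
    using ns(5,6) center_commutes[OF z] by (auto simp: center_def)
  have snc: "s * n \<in> center"
    by (rule mult_center[OF sc nc])
  have move: "ip (mult_act act m x) (mult_act act m y) = lmul (m * m) (ip x y)"
    if "m \<in> center" "star m = m" for m x y
    using ip_mult_act_right[OF that(1)] that(2) by (simp add: mult_act_properties)
  have "mult_act act (s * n) x = 0" for x
  proof -
    define v w where "v = T (mult_act act n x)" and "w = mult_act act (s * n) x"
    have "ip v v = lmul (z * (n * n)) (ip x x)"
      by (simp add: v_def gram move[OF nc ns(1)])
    also have "z * (n * n) = - (s * n * (s * n))"
      using ns(4) center_commutes[OF z, of n] by (metis mult.assoc)
    also have "lmul \<dots> (ip x x) = - ip w w"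
      unfolding w_def by (subst move[OF snc]) (use ns(1,2,3) in \<open>simp_all add: star_mult\<close>)
    finally have "ip w w + ip v v = 0" by simp
    moreover obtain a b where "ip w w = star a * a" "ip v v = star b * b"
      using ip_self_positive[of w] ip_self_positive[of v] by (auto simp: cpositive_def)
    ultimately have "ip w w = 0" using star_mult_sum_eq_0[of a b] by simp
    then show ?thesis using ip_self_eq_0_iff by (simp add: w_def)
  qed
  then have "lmul (s * n) (ip x y) = 0" for x y
    by (metis mult_act_properties(1) ip_zero_left)
  then have "s * n = 0" by (rule multiplier_eq_0_if_ip)
  then show ?thesis by (rule ns(7))
qed

text \<open>The formula for \<open>T\<^sup>*\<close> is the hypothesis with \<open>S y\<close> renamed. Its inverse \<open>S (z\<^sup>*)\<^sup>-\<^sup>1\<close> is bounded, so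
  \<open>T\<^sup>*\<close> is bounded below and \<open>T\<close> is onto; only then can the hypothesis be solved for \<open>S\<^sup>*\<close>.\<close>

lemma intertwining_pair:
  assumes S: "bij S" "bounded_linear (inv S)"
    and z: "z \<in> center" "z * w = 1" "w * z = 1"
    and TS: "\<And>x y. ip (T x) (S y) = lmul z (ip x y)"
  shows "is_adjoint ip T (\<lambda>x. mult_act act (star z) (inv S x))"
    and "is_adjoint ip S (\<lambda>x. mult_act act z (inv T x))"
    and "bounded_linear T" "bounded_linear S" "bij T"
proof -
  define G G' Gs Gs' where "G = mult_act act z" and "G' = mult_act act w"
    and "Gs = mult_act act (star z)" and "Gs' = mult_act act (star w)"
  have sw: "star w * star z = 1" "star z * star w = 1"
    using arg_cong[OF z(2), of star] arg_cong[OF z(3), of star] by (simp_all add: star_mult)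
  have GG: "G (G' x) = x" "G' (G x) = x" "Gs (Gs' x) = x" "Gs' (Gs x) = x" for x
    by (simp_all add: G_def G'_def Gs_def Gs'_def mult_act_one z sw flip: mult_act_times)
  have Si: "S (inv S x) = x" "inv S (S x) = x" for x
    using S(1) by (simp_all add: bij_is_surj surj_f_inv_f bij_is_inj)
  define T' where "T' x = Gs (inv S x)" for x
  show adjT: "is_adjoint ip T (\<lambda>x. mult_act act (star z) (inv S x))"
    unfolding is_adjoint_def
  proof (intro allI)
    fix x y
    show "ip (T x) y = ip x (mult_act act (star z) (inv S y))"
      using TS[of x "inv S y"] by (simp add: Si ip_mult_act_right[OF z(1)])
  qed
  then have adj: "is_adjoint ip T T'" by (simp add: T'_def[abs_def] Gs_def)
  have bT': "bounded_linear T'"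
    unfolding T'_def Gs_def by (rule bounded_linear_compose[OF mult_act_properties(3) S(2)])
  show bT: "bounded_linear T" by (rule is_adjoint_bounded[OF adj bT'])
  have "bounded_linear (inv (inv S))" by (rule bounded_linear_inv[OF S(2) bij_imp_bij_inv[OF S(1)]])
  then show bS: "bounded_linear S" by (simp add: inv_inv_eq[OF S(1)])
  have inj: "inj T"
  proof (rule injI)
    fix x x' assume eq: "T x = T x'"
    show "x = x'"
    proof (rule eq_if_ip_eq)
      fix y
      have "ip (G x) y = ip (G x') y"
        using TS[of x y] TS[of x' y] eq by (simp add: G_def mult_act_properties)
      moreover have "ip (G' (G x)) y = lmul w (ip (G x) y)" "ip (G' (G x')) y = lmul w (ip (G x') y)"
        by (simp_all add: G'_def mult_act_properties)
      ultimately show "ip x y = ip x' y" by (simp add: GG)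
    qed
  qed
  have "surj T"
  proof -
    have bST: "bounded_linear (\<lambda>x. S (Gs' x))"
      unfolding Gs'_def by (rule bounded_linear_compose[OF bS mult_act_properties(3)])
    from bounded_linear.pos_bounded[OF bST] obtain K where
      K: "0 < K" "\<And>x. norm (S (Gs' x)) \<le> norm x * K" by blast
    have "1 / K * norm x \<le> norm (T' x)" for x
      using K(2)[of "T' x"] K(1) by (simp add: T'_def GG Si field_simps)
    then show ?thesis
      using bounded_below_imp_adjoint_surj[OF is_adjoint_sym[OF adj] bT' bT, of "1 / K"] K(1) by simp
  qed
  with inj show bijT: "bij T" by (rule bijI)
  show "is_adjoint ip S (\<lambda>x. mult_act act z (inv T x))"
    unfolding is_adjoint_def
  proof (intro allI)
    fix x y
    have "ip (S x) y = star (ip (T (inv T y)) (S x))"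
      using bijT by (simp add: star_ip bij_is_surj surj_f_inv_f)
    also have "\<dots> = star (ip (mult_act act z (inv T y)) x)"
      by (simp add: TS mult_act_properties)
    finally show "ip (S x) y = ip x (mult_act act z (inv T y))" by (simp add: star_ip)
  qed
qed

end

theorem theorem4p5:
  fixes act :: "'a::cstar_algebra \<Rightarrow> 'e::{complex_normed_vector,banach} \<Rightarrow> 'e"
    and ip :: "'e \<Rightarrow> 'e \<Rightarrow> 'a"
    and T S :: "'e \<Rightarrow> 'e"
    and \<gamma> :: "'a multiplier"
  assumes "full_hilbert_module act ip"
    and "clinear T"
    and "clinear S" and "bij S" and "bounded_linear (inv S)"
    and "\<gamma> \<in> center" and "invertible_elt \<gamma>"
    and "\<And>x y. ip (T x) (S y) = lmul \<gamma> (ip x y)"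
  shows "bounded_linear T \<and> module_linear act T \<and> adjointable ip T \<and> bij T \<and>
    bounded_linear S \<and> module_linear act S \<and> adjointable ip S \<and> bij S \<and>
    (\<forall>x. S (op_adjoint ip T x) = mult_act act (star \<gamma>) x) \<and>
    (\<forall>x. op_adjoint ip S (T x) = mult_act act \<gamma> x) \<and>
    (\<forall>x. S (op_adjoint ip T x) = op_adjoint ip T (S x)) \<and>
    (\<forall>x. op_adjoint ip S (T x) = T (op_adjoint ip S x)) \<and>
    bij (op_adjoint ip T) \<and> (\<forall>x. S x = mult_act act (star \<gamma>) (inv (op_adjoint ip T) x)) \<and>
    bij (op_adjoint ip S) \<and> (\<forall>x. T x = mult_act act \<gamma> (inv (op_adjoint ip S) x)) \<and>
    (T = S \<longrightarrow> cpositive \<gamma> \<and>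
      (\<exists>U. unitary_operator ip U \<and> module_linear act U \<and>
        (\<forall>x. T x = mult_act act (pos_sqrt \<gamma>) (U x))))"
proof -
  interpret full_hilbert_module act ip by fact
  from assms(7) obtain \<delta> where inverse: "\<gamma> * \<delta> = 1" "\<delta> * \<gamma> = 1"
    by (auto simp: invertible_elt_def)
  define G Gs where "G = mult_act act \<gamma>" and "Gs = mult_act act (star \<gamma>)"
  have adjT: "is_adjoint ip T (\<lambda>x. Gs (inv S x))" and adjS: "is_adjoint ip S (\<lambda>x. G (inv T x))"
    and T: "bounded_linear T" "bij T" and S: "bounded_linear S"
    using intertwining_pair[OF assms(4-6) inverse assms(8)] by (simp_all add: G_def Gs_def)
  have T': "op_adjoint ip T = (\<lambda>x. Gs (inv S x))" and S': "op_adjoint ip S = (\<lambda>x. G (inv T x))"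
    by (rule op_adjoint_eq[OF adjT] op_adjoint_eq[OF adjS])+
  have inv: "S (inv S x) = x" "inv S (S x) = x" "T (inv T x) = x" "inv T (T x) = x" for x
    using assms(4) T(2) by (simp_all add: bij_is_surj surj_f_inv_f bij_is_inj)
  have commute: "S (Gs x) = Gs (S x)" "T (G x) = G (T x)" for x
    unfolding G_def Gs_def
    by (rule adjoint_commutes_mult_act[OF adjS] adjoint_commutes_mult_act[OF adjT])+
  have star_inverse: "star \<delta> * star \<gamma> = 1" "star \<gamma> * star \<delta> = 1"
    using arg_cong[OF inverse(1), of star] arg_cong[OF inverse(2), of star] by (simp_all add: star_mult)
  have bijG: "bij G" "bij Gs"
    unfolding G_def Gs_def
    by (rule mult_act_bij[OF inverse] mult_act_bij[OF star_inverse(2,1)])+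
  have bijT': "bij (\<lambda>x. Gs (inv S x))"
    using bij_comp[OF bij_imp_bij_inv[OF assms(4)] bijG(2)] by (simp add: comp_def)
  have bijS': "bij (\<lambda>x. G (inv T x))"
    using bij_comp[OF bij_imp_bij_inv[OF T(2)] bijG(1)] by (simp add: comp_def)
  have "S x = Gs (inv (\<lambda>x. Gs (inv S x)) x)" for x
  proof -
    define y where "y = inv (\<lambda>x. Gs (inv S x)) x"
    have "x = Gs (inv S y)"
      using surj_f_inv_f[OF bij_is_surj[OF bijT']] by (simp add: y_def)
    then have "S x = Gs y" by (simp add: commute inv)
    then show ?thesis by (simp add: y_def)
  qed
  moreover have "T x = G (inv (\<lambda>x. G (inv T x)) x)" for x
  proof -
    define y where "y = inv (\<lambda>x. G (inv T x)) x"
    have "x = G (inv T y)"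
      using surj_f_inv_f[OF bij_is_surj[OF bijS']] by (simp add: y_def)
    then have "T x = G y" by (simp add: commute inv)
    then show ?thesis by (simp add: y_def)
  qed
  moreover have "cpositive \<gamma> \<and> (\<exists>U. unitary_operator ip U \<and> module_linear act U \<and>
        (\<forall>x. T x = mult_act act (pos_sqrt \<gamma>) (U x)))" if "T = S"
  proof -
    have gram: "ip (T x) (T y) = lmul \<gamma> (ip x y)" for x y
      using assms(8) that by simp
    have pos: "cpositive \<gamma>"
      unfolding cpositive_iff_nonneg by (rule gram_multiplier_positive[OF assms(6) gram])
    define s where "s = pos_sqrt \<gamma>"
    have s: "cpositive s" "s * s = \<gamma>"
      using pos_sqrt_properties(1,2)[OF pos] by (simp_all add: s_def)
    have sc: "s \<in> center"
      using pos_sqrt_properties(3)[OF pos center_commutes[OF assms(6)]]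
      unfolding s_def center_def by blast
    define r where "r = s * \<delta>"
    have "s * r = 1" by (simp add: r_def s(2) inverse flip: mult.assoc)
    then have sr: "s * r = 1" "r * s = 1" using center_commutes[OF sc, of r] by simp_all
    have rc: "r \<in> center" by (rule inverse_center[OF sc sr])
    have "star s = s" using s(1) by (simp add: cpositive_iff_nonneg nonneg_def)
    then have "star r * s = 1" using arg_cong[OF sr(1), of star] by (simp add: star_mult)
    then have star_r: "star r = r" by (metis sr(1) mult.assoc mult_1_left mult_1_right)
    define U where "U x = mult_act act r (T x)" for x
    have TU: "T x = mult_act act s (U x)" for x
      by (simp add: U_def mult_act_one sr flip: mult_act_times)
    have UU: "ip (U x) (U y) = ip x y" for x y
    proof -
      have "ip (U x) (U y) = lmul (r * r * \<gamma>) (ip x y)"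
        using ip_mult_act_right[OF rc] by (simp add: U_def star_r mult_act_properties gram)
      also have "r * r * \<gamma> = r * (r * s) * s" by (simp add: mult.assoc flip: s(2))
      finally show ?thesis by (simp add: sr)
    qed
    have "bij (mult_act act r)" by (rule mult_act_bij[OF sr(2,1)])
    then have bijU: "bij U"
      using bij_comp[OF T(2)] by (simp add: U_def[abs_def] comp_def)
    then have Ui: "U (inv U x) = x" "inv U (U x) = x" for x
      by (simp_all add: bij_is_surj surj_f_inv_f bij_is_inj)
    have "is_adjoint ip U (inv U)"
      unfolding is_adjoint_def using UU by (metis Ui(1))
    then have "unitary_operator ip U" "module_linear act U"
      by (auto simp: unitary_operator_def adjointable_def op_adjoint_eq Ui is_adjoint_module_linear)
    with pos TU show ?thesis by (auto simp: s_def)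
  qed
  moreover have "module_linear act T" "module_linear act S" "adjointable ip T" "adjointable ip S"
    using adjT adjS is_adjoint_module_linear by (auto simp: adjointable_def)
  moreover have "Gs (inv S (S x)) = Gs x" "S (Gs (inv S x)) = Gs x" "G (inv T (T x)) = G x"
    "T (G (inv T x)) = G x" for x
    by (simp_all add: inv commute)
  ultimately show ?thesis
    using T S assms(4) bijT' bijS' unfolding T' S' G_def Gs_def by auto
qed

end
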